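(* Let $X$ and $Y$ be (real) Banach spaces, let $F:X\rightrightarrows Y$ be a set-valued mapping with $F(x)\neq\emptyset$ for every $x\in X$, and let $f:X\times Y\to\overline{\mathbb{R}}=[-\infty,+\infty]$. Define the marginal function $\varphi:X\to\overline{\mathbb{R}}$ by $\varphi(x):=\inf_{y\in F(x)}f(x,y)$ and the solution mapping $S:X\rightrightarrows Y$ by $S(x):=\{y\in F(x)\mid f(x,y)=\varphi(x)\}$. Let $\bar x\in X$ and suppose that: (i) $F$ satisfies the Aubin property at every point of the set $\{\bar x\}\times S(\bar x)$; (ii) there is a neighborhood $U$ of $\bar x$ and a constant $L_1>0$ such that, for every $x\in U$, the functional $f(x,\cdot)$ is Lipschitz on $Y$ with constant $L_1$ and the set $F(x)$ is closed; (iii) $f$ is locally Lipschitz on $\{\bar x\}\times S(\bar x)$; (iv) $\varphi$ is Lipschitz around $\bar x$ (i.e. locally Lipschitz at $\bar x$); (v) $S$ is inner semicompact and closed at $\bar x$. Then $$\partial^{\circ}\varphi(\bar x)\subseteq \overline{\operatorname{conv}}^{*}\left(\bigcup_{\bar y\in S(\bar x),\ (x^*,y^* )\in\partial^{\circ}f(\bar x,\bar y)}\Big[x^*+D_C^*F(\bar x,\bar y)(y^* )\Big]\right).$$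
   Context: For a normed space $X$, $X^*$ is its topological dual and $\mathbb{B}_X$ its closed unit ball; the dual of $X\times Y$ is identified with $X^*\times Y^*$ via $\langle (x^*,y^* ),(u,v)\rangle=\langle x^*,u\rangle+\langle y^*,v\rangle$. For $B\subseteq X^*$, $\overline{\operatorname{conv}}^{*}B$ is the closure of the convex hull of $B$ in the weak$^*$ topology of $X^*$. Lipschitz notions: an extended real valued functional $h$ on a normed space $Z$ is Lipschitz on a set $A\subseteq Z$ (with constant $L>0$) if $h$ is finite on $A$ and $|h(z)-h(z')|\le L\|z-z'\|$ for all $z,z'\in A$. It is locally Lipschitz at $\bar z$ if it is Lipschitz on some neighborhood of $\bar z$, and locally Lipschitz on $A$ if it is locally Lipschitz at every point of $A$. Clarke subdifferential: if $h:Z\to\overline{\mathbb{R}}$ is locally Lipschitz at $\bar z$, then $$h^{\circ}(\bar z,u):=\limsup_{z\to\bar z,\ t\downarrow 0}\frac{h(z+tu)-h(z)}{t}\quad(u\in Z),$$ $$\partial^{\circ}h(\bar z):=\{z^*\in Z^*\mid \forall\, u\in Z:\ h^{\circ}(\bar z,u)\ge\langle z^*,u\rangle\}.$$ Clarke tangent and normal cones: for nonempty $A\subseteq Z$ and $\bar z\in A$, $T(A,\bar z)$ is the set of all $u\in Z$ such that for all sequences $\{z_k\}\subseteq A$ with $z_k\to\bar z$ and all $t_k\downarrow 0$ there is a sequence $u_k\to u$ with $z_k+t_ku_k\in A$ for all $k$; and $N_C(A,\bar z):=\{z^*\in Z^*\mid \forall\, u\in T(A,\bar z):\ \langle z^*,u\rangle\le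 0\}$. Set-valued mappings: for $F:X\rightrightarrows Y$, $\operatorname{gph}F:=\{(x,y)\in X\times Y\mid y\in F(x)\}$ and $\operatorname{dom}F:=\{x\in X\mid F(x)\ne\emptyset\}$. The Clarke coderivative of $F$ at $(\bar x,\bar y)\in\operatorname{gph}F$ is the mapping $D_C^*F(\bar x,\bar y):Y^*\rightrightarrows X^*$ given by $$D_C^*F(\bar x,\bar y)(y^* ):=\{x^*\in X^*\mid (x^*,-y^* )\in N_C(\operatorname{gph}F,(\bar x,\bar y))\}.$$ $F$ satisfies the Aubin property at $(\bar x,\bar y)\in\operatorname{gph}F$ if there exist $\ell\ge 0$ and neighborhoods $U$ of $\bar x$ and $V$ of $\bar y$ such that $F(x)\cap V\subseteq F(x')+\ell\|x-x'\|_X\mathbb{B}_Y$ for all $x,x'\in U$. $S$ is inner semicompact at $\bar x\in\operatorname{dom}S$ if $\bar x\in\operatorname{int}(\operatorname{dom}S)$ and for every sequence $x_k\to\bar x$ there is a sequence $y_k\in S(x_k)$ (defined for all $k$ sufficiently large) that contains a convergent subsequence. $S$ is closed at $\bar x\in\operatorname{dom}S$ if for any sequence $\{(x_k,y_k)\}\subseteq\operatorname{gph}S$ with $(x_k,y_k)\to(\bar x,\bar y)$ one has $(\bar x,\bar y)\in\operatorname{gph}S$. *)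

theory Defs
  imports "HOL-Analysis.Analysis"
begin

section \<open>Duality\<close>

text \<open>The topological dual of \<open>'a\<close> is \<open>'a \<Rightarrow>\<^sub>L real\<close>. For real-valued operators, the strong operator
  topology (pointwise convergence on \<open>'a\<close>) is the weak-star topology.\<close>

abbreviation weak_star_topology :: "('a::real_normed_vector \<Rightarrow>\<^sub>L real) topology"
  where "weak_star_topology \<equiv> strong_operator_topology"

definition dual_pair ::
  "('a::real_normed_vector \<Rightarrow>\<^sub>L real) \<Rightarrow> ('b::real_normed_vector \<Rightarrow>\<^sub>L real) \<Rightarrow> (('a \<times> 'b) \<Rightarrow>\<^sub>L real)"
  where "dual_pair xs ys = (xs o\<^sub>L fst_blinfun) + (ys o\<^sub>L snd_blinfun)"

lemma dual_pair_apply [simp]: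
  "blinfun_apply (dual_pair xs ys) (u, v) = blinfun_apply xs u + blinfun_apply ys v"
  by (simp add: dual_pair_def blinfun.add_left)

lemma bij_dual_pair:
  "bij (\<lambda>(xs :: 'a::real_normed_vector \<Rightarrow>\<^sub>L real, ys :: 'b::real_normed_vector \<Rightarrow>\<^sub>L real). dual_pair xs ys)"
proof (rule bijI)
  show "inj (\<lambda>(xs, ys). dual_pair xs ys :: ('a \<times> 'b) \<Rightarrow>\<^sub>L real)"
  proof (rule injI, clarify)
    fix xs xs' :: "'a \<Rightarrow>\<^sub>L real" and ys ys' :: "'b \<Rightarrow>\<^sub>L real"
    assume eq: "dual_pair xs ys = dual_pair xs' ys'"
    have "blinfun_apply xs u = blinfun_apply xs' u" for u
      using arg_cong[OF eq, of "\<lambda>w. blinfun_apply w (u, 0)"] by simp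
    moreover have "blinfun_apply ys v = blinfun_apply ys' v" for v
      using arg_cong[OF eq, of "\<lambda>w. blinfun_apply w (0, v)"] by simp
    ultimately show "xs = xs' \<and> ys = ys'"
      by (simp add: blinfun_eqI)
  qed
  show "surj (\<lambda>(xs, ys). dual_pair xs ys :: ('a \<times> 'b) \<Rightarrow>\<^sub>L real)"
  proof (rule surjI)
    fix w :: "('a \<times> 'b) \<Rightarrow>\<^sub>L real"
    have bl: "bounded_linear (\<lambda>u. blinfun_apply w (u, 0))" "bounded_linear (\<lambda>v. blinfun_apply w (0, v))"
      by (intro bounded_linear_intros)+
    show "(case (Blinfun (\<lambda>u. blinfun_apply w (u, 0)), Blinfun (\<lambda>v. blinfun_apply w (0, v)))
            of (xs, ys) \<Rightarrow> dual_pair xs ys) = w"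
      by (rule blinfun_eqI)
        (auto simp: bounded_linear_Blinfun_apply[OF bl(1)] bounded_linear_Blinfun_apply[OF bl(2)]
            simp flip: blinfun.add_right)
  qed
qed

section \<open>Lipschitz properties of extended real valued functions\<close>

definition ext_lipschitz_on :: "real \<Rightarrow> 'a::metric_space set \<Rightarrow> ('a \<Rightarrow> ereal) \<Rightarrow> bool"
  where "ext_lipschitz_on L A h \<longleftrightarrow>
    0 < L \<and> (\<forall>z\<in>A. \<bar>h z\<bar> \<noteq> \<infinity>) \<and> L-lipschitz_on A (\<lambda>z. real_of_ereal (h z))"

definition locally_lipschitz_at :: "('a::metric_space \<Rightarrow> ereal) \<Rightarrow> 'a \<Rightarrow> bool"
  where "locally_lipschitz_at h z \<longleftrightarrow> (\<exists>L U. open U \<and> z \<in> U \<and> ext_lipschitz_on L U h)"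

section \<open>Clarke subdifferential, tangent cone and normal cone\<close>

text \<open>The base point in the upper limit ranges over full neighborhoods of \<open>z\<close> (including \<open>z\<close>
  itself). The next two definitions are only meaningful if \<open>h\<close> is locally Lipschitz at \<open>z\<close>.\<close>

definition clarke_deriv :: "('a::real_normed_vector \<Rightarrow> ereal) \<Rightarrow> 'a \<Rightarrow> 'a \<Rightarrow> ereal"
  where "clarke_deriv h z u =
    Limsup (nhds z \<times>\<^sub>F at_right (0::real)) (\<lambda>(z', t). (h (z' + t *\<^sub>R u) - h z') / ereal t)"

definition clarke_subdiff :: "('a::real_normed_vector \<Rightarrow> ereal) \<Rightarrow> 'a \<Rightarrow> ('a \<Rightarrow>\<^sub>L real) set"
  where "clarke_subdiff h z = {zs. \<forall>u. ereal (blinfun_apply zs u) \<le> clarke_deriv h z u}"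

definition clarke_tangent :: "'a::real_normed_vector set \<Rightarrow> 'a \<Rightarrow> 'a set"
  where "clarke_tangent A z =
    {u. \<forall>(zk :: nat \<Rightarrow> 'a) (tk :: nat \<Rightarrow> real).
          (\<forall>k. zk k \<in> A) \<and> zk \<longlonglongrightarrow> z \<and> (\<forall>k. 0 < tk k) \<and> tk \<longlonglongrightarrow> 0 \<longrightarrow>
          (\<exists>uk. uk \<longlonglongrightarrow> u \<and> (\<forall>k. zk k + tk k *\<^sub>R uk k \<in> A))}"

definition clarke_normal :: "'a::real_normed_vector set \<Rightarrow> 'a \<Rightarrow> ('a \<Rightarrow>\<^sub>L real) set"
  where "clarke_normal A z = {zs. \<forall>u\<in>clarke_tangent A z. blinfun_apply zs u \<le> 0}"

section \<open>Set-valued mappings\<close>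

definition gph :: "('a \<Rightarrow> 'b set) \<Rightarrow> ('a \<times> 'b) set"
  where "gph F = {(x, y). y \<in> F x}"

definition sv_dom :: "('a \<Rightarrow> 'b set) \<Rightarrow> 'a set"
  where "sv_dom F = {x. F x \<noteq> {}}"

definition clarke_coderiv ::
  "('a::real_normed_vector \<Rightarrow> 'b::real_normed_vector set) \<Rightarrow> 'a \<times> 'b \<Rightarrow> ('b \<Rightarrow>\<^sub>L real) \<Rightarrow> ('a \<Rightarrow>\<^sub>L real) set"
  where "clarke_coderiv F p ys = {xs. dual_pair xs (- ys) \<in> clarke_normal (gph F) p}"

definition aubin_property ::
  "('a::real_normed_vector \<Rightarrow> 'b::real_normed_vector set) \<Rightarrow> 'a \<times> 'b \<Rightarrow> bool"
  where "aubin_property F p \<longleftrightarrow>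
    (\<exists>l\<ge>0. \<exists>U V. open U \<and> fst p \<in> U \<and> open V \<and> snd p \<in> V \<and>
      (\<forall>x\<in>U. \<forall>x'\<in>U. F x \<inter> V \<subseteq> {y + (l * norm (x - x')) *\<^sub>R b | y b. y \<in> F x' \<and> b \<in> cball 0 1}))"

definition inner_semicompact_at ::
  "('a::topological_space \<Rightarrow> 'b::topological_space set) \<Rightarrow> 'a \<Rightarrow> bool"
  where "inner_semicompact_at S x \<longleftrightarrow>
    x \<in> interior (sv_dom S) \<and>
    (\<forall>xk. xk \<longlonglongrightarrow> x \<longrightarrow>
      (\<exists>yk. (\<forall>\<^sub>F k in sequentially. yk k \<in> S (xk k)) \<and>
            (\<exists>r y. strict_mono r \<and> (yk \<circ> r) \<longlonglongrightarrow> y)))"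

definition closed_mapping_at ::
  "('a::topological_space \<Rightarrow> 'b::topological_space set) \<Rightarrow> 'a \<Rightarrow> bool"
  where "closed_mapping_at S x \<longleftrightarrow>
    x \<in> sv_dom S \<and>
    (\<forall>xk yk y. (\<forall>k. (xk k, yk k) \<in> gph S) \<and> (\<lambda>k. (xk k, yk k)) \<longlonglongrightarrow> (x, y) \<longrightarrow> (x, y) \<in> gph S)"

section \<open>Marginal function and solution mapping\<close>

definition marginal :: "('a \<times> 'b \<Rightarrow> ereal) \<Rightarrow> ('a \<Rightarrow> 'b set) \<Rightarrow> 'a \<Rightarrow> ereal"
  where "marginal f F x = (INF y\<in>F x. f (x, y))"

definition solution_map :: "('a \<times> 'b \<Rightarrow> ereal) \<Rightarrow> ('a \<Rightarrow> 'b set) \<Rightarrow> 'a \<Rightarrow> 'b set"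
  where "solution_map f F x = {y \<in> F x. f (x, y) = marginal f F x}"

end

theory Submission
  imports Defs
begin

text \<open>By exact penalisation, \<open>marginal f F x\<close> is bounded above by \<open>f (x, y) + L * infdist y (F x)\<close>
  for all \<open>y\<close>, with equality at solutions. Choosing solutions along a sequence that realises the
  Clarke derivative of the marginal function at \<open>xb\<close> in direction \<open>u\<close> and passing to a cluster point
  \<open>yb\<close> bounds this derivative, for every \<open>v\<close>, by the sum of the Clarke derivatives of \<open>f\<close> and of the
  penalty at \<open>(xb, yb)\<close> in direction \<open>(u, v)\<close>. A Hahn-Banach argument splits this bound into a
  subgradient of \<open>f\<close> and a subgradient of the penalty with opposite second components. The Aubin
  property makes the penalty locally Lipschitz, and since the penalty is Lipschitz in \<open>y\<close> for fixed \<open>x\<close>,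
  its derivative is nonpositive on the Clarke tangent cone of the graph, so its subgradients are normals.
  This gives the inequality of support functions, which is turned into the inclusion by weak-star
  separation.\<close>

section \<open>Dominated linear functionals and weak-star separation\<close>

definition sublinear :: "('a::real_vector \<Rightarrow> real) \<Rightarrow> bool"
  where "sublinear p \<longleftrightarrow>
    (\<forall>x y. p (x + y) \<le> p x + p y) \<and> (\<forall>c x. 0 \<le> c \<longrightarrow> p (c *\<^sub>R x) = c * p x)"

text \<open>Applying the scaling inequality with \<open>inverse c\<close> to
  \<open>c *\<^sub>R x\<close> reverses it, so one-sided conditions give equality.\<close>

lemma sublinearI:
  assumes add: "\<And>x y. p (x + y) \<le> p x + p y"
    and scale: "\<And>c x. 0 < c \<Longrightarrow> p (c *\<^sub>R x) \<le> c * p x"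
    and zero: "p 0 \<le> 0"
  shows "sublinear p"
proof -
  have p0: "p 0 = 0"
    using add[of 0 0] zero by simp
  have "p (c *\<^sub>R x) = c * p x" if "0 < c" for c x
  proof -
    have "p x \<le> inverse c * p (c *\<^sub>R x)"
      using scale[of "inverse c" "c *\<^sub>R x"] that by simp
    then have "c * p x \<le> p (c *\<^sub>R x)"
      using that by (simp add: field_simps)
    with scale[OF that, of x] show ?thesis by simp
  qed
  then have "p (c *\<^sub>R x) = c * p x" if "0 \<le> c" for c x
    using that p0 by (cases "c = 0") auto
  with add show ?thesis by (simp add: sublinear_def)
qed

lemma sublinear_add: "sublinear p \<Longrightarrow> p (x + y) \<le> p x + p y"
  and sublinear_scale: "sublinear p \<Longrightarrow> 0 \<le> c \<Longrightarrow> p (c *\<^sub>R x) = c * p x"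
  by (auto simp: sublinear_def)

lemma sublinear_0: "sublinear p \<Longrightarrow> p 0 = 0"
  using sublinear_scale[of p 0 0] by simp

lemma sublinear_minus: "sublinear p \<Longrightarrow> - p (- x) \<le> p x"
  using sublinear_add[of p x "- x"] by (simp add: sublinear_0)

text \<open>The witness is \<open>q x = (INF t\<ge>0. INF k\<in>C. p (x + t *\<^sub>R k) - t * \<gamma>)\<close>. A minimal sublinear
  functional has to coincide with its own \<open>q\<close> for \<open>C = {x}\<close>, which makes it linear.\<close>

lemma sublinear_below_convex:
  fixes p :: "'a::real_vector \<Rightarrow> real"
  assumes p: "sublinear p" and C: "convex C" "C \<noteq> {}" and le: "\<And>k. k \<in> C \<Longrightarrow> \<gamma> \<le> p k"
  obtains q where "sublinear q" "q \<le> p" "\<And>k. k \<in> C \<Longrightarrow> q (- k) \<le> - \<gamma>"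
proof -
  define I where "I = {0::real..} \<times> C"
  define g where "g = (\<lambda>x (t, k). p (x + t *\<^sub>R k) - t * \<gamma>)"
  define q where "q x = (INF i\<in>I. g x i)" for x
  have I: "I \<noteq> {}"
    using C by (auto simp: I_def)
  \<comment> \<open>This bound, from \<open>\<gamma> \<le> p k\<close> and subadditivity, keeps the
    infimum over the reals from degenerating.\<close>
  have lower: "- p (- x) \<le> g x i" if "i \<in> I" for x i
  proof -
    from that obtain t k where i: "i = (t, k)" "0 \<le> t" "k \<in> C"
      by (auto simp: I_def)
    have "t * \<gamma> \<le> p (t *\<^sub>R k)"
      using i le by (simp add: sublinear_scale[OF p] mult_left_mono)
    moreover have "p (t *\<^sub>R k) \<le> p (x + t *\<^sub>R k) + p (- x)"
      using sublinear_add[OF p, of "x + t *\<^sub>R k" "- x"] by simp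
    ultimately show ?thesis by (simp add: g_def i)
  qed
  have bdd: "bdd_below (g x ` I)" for x
    by (rule bdd_belowI2[of _ "- p (- x)"]) (rule lower)
  have q_le: "q x \<le> g x i" if "i \<in> I" for x i
    unfolding q_def by (rule cINF_lower[OF bdd that])
  have q_ge: "m \<le> q x" if "\<And>i. i \<in> I \<Longrightarrow> m \<le> g x i" for m x
    unfolding q_def by (rule cINF_greatest[OF I that])
  have qp: "q x \<le> p x" for x
  proof -
    obtain k where "k \<in> C" using C by auto
    then show ?thesis using q_le[of "(0, k)" x] by (simp add: I_def g_def)
  qed
  show thesis
  proof
    show "sublinear q"
    proof (rule sublinearI)
      fix x y
      have key: "q (x + y) \<le> g x i + g y j" if ij: "i \<in> I" "j \<in> I" for i j
      proof -
        obtain t k s l where i: "i = (t, k)" "0 \<le> t" "k \<in> C" and j: "j = (s, l)" "0 \<le> s" "l \<in> C"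
          using ij by (auto simp: I_def)
        \<comment> \<open>The two multiples merge into one multiple of the weighted mean of
          \<open>k\<close> and \<open>l\<close>; at total weight zero any point of \<open>C\<close>
          serves.\<close>
        obtain m where m: "m \<in> C" "t *\<^sub>R k + s *\<^sub>R l = (t + s) *\<^sub>R m"
        proof (cases "t + s = 0")
          case True
          then have "t = 0" "s = 0" using i j by auto
          then show ?thesis using that[OF i(3)] by simp
        next
          case False
          then have pos: "0 < t + s" using i j by auto
          let ?m = "(t / (t + s)) *\<^sub>R k + (s / (t + s)) *\<^sub>R l"
          have "?m \<in> C"
            using i j pos by (intro convexD[OF C(1)]) (auto simp flip: add_divide_distrib)
          moreover have "(t + s) *\<^sub>R ?m = t *\<^sub>R k + s *\<^sub>R l"
            using False by (simp add: scaleR_add_right)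
          ultimately show ?thesis using that by metis
        qed
        have "q (x + y) \<le> g (x + y) (t + s, m)"
          using i j m by (intro q_le) (auto simp: I_def)
        also have "\<dots> = p ((x + t *\<^sub>R k) + (y + s *\<^sub>R l)) - (t + s) * \<gamma>"
          by (simp add: g_def flip: m(2)) (simp add: algebra_simps)
        also have "\<dots> \<le> g x i + g y j"
          using sublinear_add[OF p, of "x + t *\<^sub>R k" "y + s *\<^sub>R l"]
          by (simp add: g_def i j algebra_simps)
        finally show ?thesis .
      qed
      have "q (x + y) - g y j \<le> q x" if "j \<in> I" for j
        using key[OF _ that] by (intro q_ge) (simp add: algebra_simps)
      then have "q (x + y) - q x \<le> q y"
        by (intro q_ge) (simp add: algebra_simps)
      then show "q (x + y) \<le> q x + q y" by simp
    next
      fix c x assume c: "(0::real) < c"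
      have "q (c *\<^sub>R x) / c \<le> q x"
      proof (rule q_ge)
        fix i assume "i \<in> I"
        then obtain t k where i: "i = (t, k)" "0 \<le> t" "k \<in> C"
          by (auto simp: I_def)
        have "q (c *\<^sub>R x) \<le> g (c *\<^sub>R x) (c * t, k)"
          using i c by (intro q_le) (auto simp: I_def)
        also have "\<dots> = c * g x i"
          using sublinear_scale[OF p, of c "x + t *\<^sub>R k"] c
          by (simp add: g_def i algebra_simps)
        finally show "q (c *\<^sub>R x) / c \<le> g x i"
          using c by (simp add: field_simps)
      qed
      then show "q (c *\<^sub>R x) \<le> c * q x"
        using c by (simp add: field_simps)
    next
      show "q 0 \<le> 0" using qp[of 0] by (simp add: sublinear_0[OF p])
    qed
    show "q \<le> p" using qp by (simp add: le_fun_def)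
    show "q (- k) \<le> - \<gamma>" if "k \<in> C" for k
      using q_le[of "(1, k)" "- k"] that by (simp add: I_def g_def sublinear_0[OF p])
  qed
qed

text \<open>Zorn's lemma in the reversed pointwise order \<open>P\<close>, so that maximal means
  minimal. A nonempty chain is bounded by its pointwise infimum, which is finite because every
  member is at least \<open>- p (- x)\<close> at \<open>x\<close>.\<close>

lemma minimal_sublinear_below:
  fixes p :: "'a::real_vector \<Rightarrow> real"
  assumes p: "sublinear p"
  obtains q where "sublinear q" "q \<le> p" "\<And>r. sublinear r \<Longrightarrow> r \<le> q \<Longrightarrow> r = q"
proof -
  define A where "A = {q. sublinear q \<and> q \<le> p}"
  define P where "P = (\<lambda>q r. (r::'a \<Rightarrow> real) \<le> q)"
  have "\<exists>m\<in>A. \<forall>a\<in>A. P m a \<longrightarrow> a = m"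
  proof (rule predicate_Zorn)
    show "partial_order_on A (relation_of P A)"
      by (rule partial_order_on_relation_ofI) (auto simp: P_def)
  next
    fix Q assume Q: "Q \<in> Chains (relation_of P A)"
    have QA: "sublinear a" "a \<le> p" if "a \<in> Q" for a
      using Q that by (auto simp: Chains_def relation_of_def A_def)
    have chain: "a \<le> b \<or> b \<le> a" if "a \<in> Q" "b \<in> Q" for a b
      using Q that by (auto simp: Chains_def relation_of_def P_def)
    show "\<exists>u\<in>A. \<forall>a\<in>Q. P a u"
    proof (cases "Q = {}")
      case True
      then show ?thesis using p by (auto simp: A_def)
    next
      case ne: False
      define u where "u x = (INF a\<in>Q. a x)" for x
      have lower: "- p (- x) \<le> a x" if "a \<in> Q" for a x
        using QA[OF that] sublinear_minus[of a x] by (auto simp: le_fun_def intro: order_trans[rotated])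
      have bdd: "bdd_below ((\<lambda>a. a x) ` Q)" for x
        by (rule bdd_belowI2[of _ "- p (- x)"]) (rule lower)
      have u_le: "u x \<le> a x" if "a \<in> Q" for x a
        unfolding u_def by (rule cINF_lower[OF bdd that])
      have u_ge: "m \<le> u x" if "\<And>a. a \<in> Q \<Longrightarrow> m \<le> a x" for m x
        unfolding u_def by (rule cINF_greatest[OF ne that])
      have "sublinear u"
      proof (rule sublinearI)
        fix x y
        have key: "u (x + y) \<le> a x + b y" if ab: "a \<in> Q" "b \<in> Q" for a b
        proof -
          \<comment> \<open>The smaller of two comparable members bounds both summands, so
            \<open>a\<close> and \<open>b\<close> may vary independently in the infimum.\<close>
          obtain c where c: "c \<in> Q" "c \<le> a" "c \<le> b"
            using chain[OF ab] ab by auto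
          have "u (x + y) \<le> c x + c y"
            using u_le[OF c(1)] sublinear_add[OF QA(1)[OF c(1)]] order_trans by blast
          then show ?thesis
            using le_funD[OF c(2), of x] le_funD[OF c(3), of y] by linarith
        qed
        have "u (x + y) - b y \<le> u x" if "b \<in> Q" for b
          using key[OF _ that] by (intro u_ge) (simp add: algebra_simps)
        then have "u (x + y) - u x \<le> u y"
          by (intro u_ge) (simp add: algebra_simps)
        then show "u (x + y) \<le> u x + u y" by simp
      next
        fix c x assume c: "(0::real) < c"
        have "u (c *\<^sub>R x) / c \<le> u x"
        proof (rule u_ge)
          fix a assume a: "a \<in> Q"
          show "u (c *\<^sub>R x) / c \<le> a x"
            using u_le[OF a, of "c *\<^sub>R x"] sublinear_scale[OF QA(1)[OF a], of c x] c
            by (simp add: field_simps)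
        qed
        then show "u (c *\<^sub>R x) \<le> c * u x"
          using c by (simp add: field_simps)
      next
        obtain a where "a \<in> Q" using ne by auto
        then show "u 0 \<le> 0" using u_le[of a 0] QA sublinear_0 by metis
      qed
      moreover have "u \<le> p"
        using ne u_le QA(2) by (metis ex_in_conv le_fun_def order_trans)
      ultimately show ?thesis
        using u_le by (auto simp: A_def P_def le_fun_def)
    qed
  qed
  then show thesis using that by (auto simp: A_def P_def intro: order_trans)
qed

lemma sublinear_minimal_imp_linear:
  fixes q :: "'a::real_vector \<Rightarrow> real"
  assumes q: "sublinear q" and min: "\<And>r. sublinear r \<Longrightarrow> r \<le> q \<Longrightarrow> r = q"
  shows "linear q"
proof -
  have minus: "q (- x) = - q x" for x
  proof -
    obtain r where r: "sublinear r" "r \<le> q" "r (- x) \<le> - q x"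
      using sublinear_below_convex[OF q, of "{x}" "q x"] by auto
    then have "q (- x) \<le> - q x" using min by metis
    then show ?thesis using sublinear_minus[OF q, of x] by simp
  qed
  \<comment> \<open>Oddness turns subadditivity at \<open>- x\<close> and \<open>- y\<close> into
    the reverse inequality.\<close>
  have add: "q (x + y) = q x + q y" for x y
    using sublinear_add[OF q, of x y] sublinear_add[OF q, of "- x" "- y"] minus[of "x + y"]
    by (simp add: minus)
  have "q (c *\<^sub>R x) = c * q x" for c x
  proof (cases "0 \<le> c")
    case True
    then show ?thesis by (rule sublinear_scale[OF q])
  next
    case False
    then show ?thesis
      using sublinear_scale[OF q, of "- c" x] minus[of "c *\<^sub>R x"] by simp
  qed
  with add show ?thesis by (auto intro: linearI)
qed

text \<open>A minimal sublinear functional below the \<open>q\<close> of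
  \<open>sublinear_below_convex\<close> is linear, and linearity turns its upper bound at
  \<open>- k\<close> into the lower bound at \<open>k\<close>.\<close>

lemma mazur_orlicz:
  fixes p :: "'a::real_vector \<Rightarrow> real"
  assumes p: "sublinear p" and C: "convex C" and le: "\<And>k. k \<in> C \<Longrightarrow> \<gamma> \<le> p k"
  obtains l where "linear l" "l \<le> p" "\<And>k. k \<in> C \<Longrightarrow> \<gamma> \<le> l k"
proof -
  obtain q where q: "sublinear q" "q \<le> p" "\<And>k. k \<in> C \<Longrightarrow> q (- k) \<le> - \<gamma>"
  proof (cases "C = {}")
    case True
    then show ?thesis using p that[of p] by simp
  next
    case False
    then show ?thesis using sublinear_below_convex[OF p C _ le] that by metis
  qed
  obtain l where l: "sublinear l" "l \<le> q" "\<And>r. sublinear r \<Longrightarrow> r \<le> l \<Longrightarrow> r = l"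
    using minimal_sublinear_below[OF q(1)] by metis
  have lin: "linear l" using sublinear_minimal_imp_linear l by metis
  show thesis
  proof
    show "\<gamma> \<le> l k" if "k \<in> C" for k
      using le_funD[OF l(2), of "- k"] q(3)[OF that] by (simp add: linear_neg[OF lin])
  qed (use lin l q in auto)
qed

section \<open>Weak-star topology: finitely many evaluations and separation by a point\<close>

text \<open>A linear combination of evaluations is evaluation at the combined vector, so induction
  can remove one point of the kernel condition at a time.\<close>

lemma linear_eq_evaluation:
  fixes l :: "('a::real_normed_vector \<Rightarrow>\<^sub>L real) \<Rightarrow> real"
  assumes "finite I" "linear l" "\<And>z. (\<And>i. i \<in> I \<Longrightarrow> blinfun_apply z i = 0) \<Longrightarrow> l z = 0"
  shows "\<exists>u. \<forall>z. l z = blinfun_apply z u"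
  using assms
proof (induction I arbitrary: l rule: finite_induct)
  case empty
  then show ?case by (intro exI[of _ 0]) (simp add: blinfun.zero_right)
next
  case (insert j I)
  show ?case
  proof (cases "\<exists>e :: 'a \<Rightarrow>\<^sub>L real. (\<forall>i\<in>I. blinfun_apply e i = 0) \<and> blinfun_apply e j \<noteq> 0")
    case False
    \<comment> \<open>Here evaluation at \<open>j\<close> vanishes wherever those at
      \<open>I\<close> do, so \<open>j\<close> adds no restriction.\<close>
    have "l z = 0" if "\<And>i. i \<in> I \<Longrightarrow> blinfun_apply z i = 0" for z
    proof (rule insert.prems(2))
      have "\<forall>i\<in>I. blinfun_apply z i = 0"
        using that by simp
      with False have "blinfun_apply z j = 0"
        by blast
      then show "blinfun_apply z i = 0" if "i \<in> insert j I" for i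
        using that \<open>\<And>i. i \<in> I \<Longrightarrow> blinfun_apply z i = 0\<close> by auto
    qed
    then show ?thesis by (rule insert.IH[OF insert.prems(1)])
  next
    case True
    then obtain e :: "'a \<Rightarrow>\<^sub>L real" where e: "\<forall>i\<in>I. blinfun_apply e i = 0" "blinfun_apply e j \<noteq> 0" by blast
    \<comment> \<open>Subtracting \<open>c\<close> times evaluation at \<open>j\<close> makes
      \<open>l\<close> vanish at \<open>e\<close>; any \<open>z\<close> killed on \<open>I\<close>
      differs by a multiple of \<open>e\<close> from one killed on
      \<open>insert j I\<close>.\<close>
    define c where "c = l e / blinfun_apply e j"
    have "\<exists>u. \<forall>z. l z - c * blinfun_apply z j = blinfun_apply z u"
    proof (rule insert.IH)
      show "linear (\<lambda>z. l z - c * blinfun_apply z j)"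
        by (rule linearI)
          (simp_all add: linear_add[OF insert.prems(1)] linear_scale[OF insert.prems(1)]
            blinfun.add_left blinfun.scaleR_left algebra_simps)
    next
      fix z :: "'a \<Rightarrow>\<^sub>L real"
      assume z: "\<And>i. i \<in> I \<Longrightarrow> blinfun_apply z i = 0"
      let ?w = "z - (blinfun_apply z j / blinfun_apply e j) *\<^sub>R e"
      have "l ?w = 0"
        using z e by (intro insert.prems(2)) (auto simp: blinfun.diff_left blinfun.scaleR_left)
      then show "l z - c * blinfun_apply z j = 0"
        by (simp add: linear_diff[OF insert.prems(1)] linear_scale[OF insert.prems(1)] c_def)
    qed
    then obtain u where "\<forall>z. l z - c * blinfun_apply z j = blinfun_apply z u" by blast
    then have "\<forall>z. l z = blinfun_apply z (u + c *\<^sub>R j)"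
      by (simp add: blinfun.add_right blinfun.scaleR_right algebra_simps)
    then show ?thesis by blast
  qed
qed

text \<open>The topology is pulled back from a product, where a basic open box restricts only
  finitely many coordinates; \<open>e\<close> is the least radius over these.\<close>

lemma weak_star_neighborhood:
  fixes x :: "'a::real_normed_vector \<Rightarrow>\<^sub>L real"
  assumes "openin weak_star_topology T" "x \<in> T"
  obtains I e where "finite I" "0 < e"
    "\<And>z. (\<And>i. i \<in> I \<Longrightarrow> \<bar>blinfun_apply (z - x) i\<bar> < e) \<Longrightarrow> z \<in> T"
proof -
  obtain W where W: "open W" "T = blinfun_apply -` W"
    using assms(1) unfolding strong_operator_topology_def openin_pullback_topology by auto
  have "openin (product_topology (\<lambda>i. euclidean) UNIV) W" 
    using W(1) by (simp add: open_fun_def)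
  moreover have "blinfun_apply x \<in> W" using assms W by auto
  ultimately obtain X where X: "blinfun_apply x \<in> Pi\<^sub>E UNIV X" "\<And>i. open (X i)"
    "finite {i. X i \<noteq> UNIV}" "Pi\<^sub>E UNIV X \<subseteq> W"
    using product_topology_open_contains_basis[of "\<lambda>_. euclidean" UNIV W "blinfun_apply x"]
    by (auto simp: open_openin[symmetric])
  have "blinfun_apply x i \<in> X i" for i
    using X(1) by auto
  then have "\<exists>e>0. ball (blinfun_apply x i) e \<subseteq> X i" for i
    using X(2) openE by metis
  then obtain d where d: "\<And>i. 0 < d i" "\<And>i. ball (blinfun_apply x i) (d i) \<subseteq> X i" by metis
  define I where "I = {i. X i \<noteq> UNIV}"
  \<comment> \<open>The inserted \<open>1\<close> keeps the minimum meaningful when \<open>I\<close>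
    is empty.\<close>
  define e where "e = Min (insert 1 (d ` I))"
  have fin: "finite I" using X(3) by (simp add: I_def)
  have e: "0 < e" "\<And>i. i \<in> I \<Longrightarrow> e \<le> d i"
    using fin d(1) by (auto simp: e_def)
  show thesis
  proof (rule that[OF fin e(1)])
    fix z assume z: "\<And>i. i \<in> I \<Longrightarrow> \<bar>blinfun_apply (z - x) i\<bar> < e"
    have "blinfun_apply z i \<in> X i" for i
    proof (cases "i \<in> I")
      case True
      then have "dist (blinfun_apply x i) (blinfun_apply z i) < d i"
        using z[OF True] e(2)[OF True] by (simp add: dist_real_def blinfun.diff_left)
      then show ?thesis using d(2) by (auto simp: subset_iff)
    qed (simp add: I_def)
    then have "blinfun_apply z \<in> W" using X(4) by auto
    then show "z \<in> T" using W by simp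
  qed
qed

text \<open>A basic neighborhood of \<open>x\<close> missing \<open>C\<close> makes the seminorm
  \<open>p\<close> at least \<open>e\<close> on the translate of \<open>C\<close> by
  \<open>- x\<close>. The functional from \<open>mazur_orlicz\<close> keeps this bound and, being
  dominated by \<open>p\<close>, vanishes on the common kernel of finitely many evaluations; hence
  it is itself an evaluation.\<close>

lemma weak_star_separation:
  fixes x :: "'a::real_normed_vector \<Rightarrow>\<^sub>L real"
  assumes C: "convex C" and x: "x \<notin> weak_star_topology closure_of C"
  obtains u where "\<And>z. z \<in> C \<Longrightarrow> blinfun_apply z u < blinfun_apply x u"
proof -
  obtain T where T: "openin weak_star_topology T" "x \<in> T" "T \<inter> C = {}"
    using x by (auto simp: in_closure_of strong_operator_topology_topspace)
  obtain I e where I: "finite I" "0 < e"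
    and nb: "\<And>z. (\<And>i. i \<in> I \<Longrightarrow> \<bar>blinfun_apply (z - x) i\<bar> < e) \<Longrightarrow> z \<in> T"
    using weak_star_neighborhood[OF T(1,2)] by metis
  define p where "p z = (\<Sum>i\<in>I. \<bar>blinfun_apply z i\<bar>)" for z :: "'a \<Rightarrow>\<^sub>L real"
  have p: "sublinear p"
  proof (rule sublinearI)
    show "p (z + w) \<le> p z + p w" for z w
      unfolding p_def sum.distrib[symmetric]
      by (rule sum_mono) (simp add: blinfun.add_left abs_triangle_ineq)
  qed (simp_all add: p_def blinfun.scaleR_left abs_mult sum_distrib_left)
  have le: "e \<le> p k" if "k \<in> (\<lambda>z. z - x) ` C" for k
  proof (rule ccontr)
    assume less: "\<not> e \<le> p k"
    from that obtain z where z: "z \<in> C" "k = z - x" by auto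
    have "\<bar>blinfun_apply (z - x) i\<bar> < e" if "i \<in> I" for i
    proof -
      have "\<bar>blinfun_apply (z - x) i\<bar> \<le> p k"
        unfolding p_def z(2) using that I(1) by (intro member_le_sum) auto
      then show ?thesis using less by simp
    qed
    then have "z \<in> T" by (rule nb)
    then show False using T(3) z(1) by auto
  qed
  obtain l where l: "linear l" "l \<le> p" "\<And>k. k \<in> (\<lambda>z. z - x) ` C \<Longrightarrow> e \<le> l k"
    using mazur_orlicz[OF p _ le] convex_translation_subtract[OF C] by metis
  have "l z = 0" if "\<And>i. i \<in> I \<Longrightarrow> blinfun_apply z i = 0" for z
  proof -
    have "p z = 0" "p (- z) = 0"
      using that by (auto simp: p_def blinfun.minus_left)
    then show ?thesis
      using le_funD[OF l(2), of z] le_funD[OF l(2), of "- z"] by (simp add: linear_neg[OF l(1)])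
  qed
  then obtain u where u: "\<And>z. l z = blinfun_apply z u"
    using linear_eq_evaluation[OF I(1) l(1)] by blast
  show thesis
  proof
    fix z assume "z \<in> C"
    then have "e \<le> blinfun_apply (z - x) u" using l(3) u by simp
    then show "blinfun_apply z (- u) < blinfun_apply x (- u)"
      using I(2) by (simp add: blinfun.diff_left blinfun.minus_right)
  qed
qed

section \<open>The Clarke directional derivative of a locally Lipschitz function\<close>

abbreviation base_step_filter :: "'a::real_normed_vector \<Rightarrow> ('a \<times> real) filter"
  where "base_step_filter z \<equiv> nhds z \<times>\<^sub>F at_right 0"

text \<open>Infinite values of \<open>h\<close> are read as \<open>0\<close>, so this is the true
  increment only where \<open>h\<close> is finite.\<close>

abbreviation increment :: "('a::real_normed_vector \<Rightarrow> ereal) \<Rightarrow> 'a \<Rightarrow> 'a \<times> real \<Rightarrow> real"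
  where "increment h u w \<equiv>
    real_of_ereal (h (fst w + snd w *\<^sub>R u)) - real_of_ereal (h (fst w))"

lemma base_step_filter_neq_bot: "base_step_filter z \<noteq> bot"
  by (simp add: prod_filter_eq_bot)

lemma eventually_step_pos: "\<forall>\<^sub>F w in base_step_filter z. 0 < snd w"
proof (rule eventually_compose_filterlim[OF _ filterlim_snd])
  show "\<forall>\<^sub>F t in at_right (0::real). 0 < t"
    by (rule eventually_at_right_less)
qed

lemma filterlim_base_shift:
  "filterlim (\<lambda>w. fst w + snd w *\<^sub>R u) (nhds z) (base_step_filter z)"
proof -
  have "(snd \<longlongrightarrow> (0::real)) (base_step_filter z)"
    using filterlim_mono[OF filterlim_snd at_within_le_nhds order_refl] .
  from tendsto_add[OF filterlim_fst tendsto_scaleR[OF this tendsto_const]]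
  show ?thesis by simp
qed

text \<open>A diagonal choice: the \<open>k\<close>-th pair satisfies \<open>P k\<close> and lies
  within \<open>inverse (real (Suc k))\<close> of the limit in both components.\<close>

lemma frequently_sequence:
  assumes "\<And>k. \<exists>\<^sub>F w in base_step_filter z. P k w"
  obtains zk tk where "zk \<longlonglongrightarrow> z" "tk \<longlonglongrightarrow> 0" "\<And>k. 0 < tk k" "\<And>k::nat. P k (zk k, tk k)"
proof -
  have "\<exists>w. P k w \<and> dist (fst w) z < inverse (real (Suc k)) \<and> 0 < snd w \<and> snd w < inverse (real (Suc k))"
    for k
  proof -
    have "\<forall>\<^sub>F w in base_step_filter z. dist (fst w) z < inverse (real (Suc k))"
      by (rule eventually_compose_filterlim[OF _ filterlim_fst])
        (simp add: eventually_nhds_metric, metis inverse_positive_iff_positive of_nat_0_less_iff zero_less_Suc of_nat_Suc)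
    moreover have "\<forall>\<^sub>F w in base_step_filter z. snd w < inverse (real (Suc k))"
      by (rule eventually_compose_filterlim[OF _ filterlim_snd])
        (rule eventually_at_rightI[of 0 "inverse (real (Suc k))"], auto)
    ultimately have "\<forall>\<^sub>F w in base_step_filter z.
        dist (fst w) z < inverse (real (Suc k)) \<and> 0 < snd w \<and> snd w < inverse (real (Suc k))"
      using eventually_step_pos by eventually_elim auto
    with assms[of k] show ?thesis
      by (metis (mono_tags, lifting) frequently_eventually_conj frequently_ex)
  qed
  then obtain w where w: "\<And>k. P k (w k)" "\<And>k. dist (fst (w k)) z < inverse (real (Suc k))"
    "\<And>k. 0 < snd (w k)" "\<And>k. snd (w k) < inverse (real (Suc k))"
    by metis
  show thesis
  proof
    show "(\<lambda>k. fst (w k)) \<longlonglongrightarrow> z"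
      unfolding tendsto_dist_iff[of "\<lambda>k. fst (w k)"]
      by (rule tendsto_sandwich[OF _ _ tendsto_const LIMSEQ_inverse_real_of_nat])
        (use less_imp_le[OF w(2)] in simp_all)
    show "(\<lambda>k. snd (w k)) \<longlonglongrightarrow> 0"
      by (rule tendsto_sandwich[OF _ _ tendsto_const LIMSEQ_inverse_real_of_nat])
        (use less_imp_le[OF w(3)] less_imp_le[OF w(4)] in simp_all)
  qed (use w in auto)
qed

lemma locally_lipschitz_atE:
  assumes "locally_lipschitz_at h z"
  obtains L U where "0 < L" "open U" "z \<in> U" "\<And>w. w \<in> U \<Longrightarrow> \<bar>h w\<bar> \<noteq> \<infinity>"
    "\<And>v w. v \<in> U \<Longrightarrow> w \<in> U \<Longrightarrow> \<bar>real_of_ereal (h v) - real_of_ereal (h w)\<bar> \<le> L * dist v w"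
proof -
  obtain L U where LU: "open U" "z \<in> U" "ext_lipschitz_on L U h"
    using assms by (auto simp: locally_lipschitz_at_def)
  show thesis
    by (rule that[of L U])
      (use LU in \<open>auto simp: ext_lipschitz_on_def dist_real_def dest: lipschitz_onD\<close>)
qed

text \<open>Finiteness allows passing from extended to real difference quotients. Choosing
  \<open>L\<close> before \<open>u\<close> yields a bound of the derivative linear in
  \<open>norm u\<close>.\<close>

lemma eventually_increment_bound:
  assumes "locally_lipschitz_at h z"
  shows "\<exists>L>0. \<forall>u. \<forall>\<^sub>F w in base_step_filter z. \<bar>h (fst w)\<bar> \<noteq> \<infinity> \<and> \<bar>h (fst w + snd w *\<^sub>R u)\<bar> \<noteq> \<infinity> \<and>
      \<bar>increment h u w\<bar> \<le> L * norm u * snd w"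
proof -
  obtain L U where L: "0 < L" and U: "open U" "z \<in> U" and fin: "\<And>w. w \<in> U \<Longrightarrow> \<bar>h w\<bar> \<noteq> \<infinity>"
    and lip: "\<And>v w. v \<in> U \<Longrightarrow> w \<in> U \<Longrightarrow> \<bar>real_of_ereal (h v) - real_of_ereal (h w)\<bar> \<le> L * dist v w"
    using locally_lipschitz_atE[OF assms] by metis
  have nhd: "\<forall>\<^sub>F w in nhds z. w \<in> U" using U by (rule eventually_nhds_in_open)
  show ?thesis
  proof (intro exI[of _ L] conjI[OF L] allI)
    fix u
    show "\<forall>\<^sub>F w in base_step_filter z. \<bar>h (fst w)\<bar> \<noteq> \<infinity> \<and> \<bar>h (fst w + snd w *\<^sub>R u)\<bar> \<noteq> \<infinity> \<and>
        \<bar>increment h u w\<bar> \<le> L * norm u * snd w"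
      using eventually_compose_filterlim[OF nhd filterlim_fst[of _ "at_right (0::real)"]]
        eventually_compose_filterlim[OF nhd filterlim_base_shift[of u]] eventually_step_pos
    proof eventually_elim
      case (elim w)
      then show ?case
        using lip[of "fst w + snd w *\<^sub>R u" "fst w"] fin by (simp add: dist_norm mult_ac)
    qed
  qed
qed

lemma clarke_deriv_eq_Limsup_real:
  assumes "locally_lipschitz_at h z"
  shows "clarke_deriv h z u = Limsup (base_step_filter z) (\<lambda>w. ereal (increment h u w / snd w))"
  unfolding clarke_deriv_def
proof (rule Limsup_eq)
  obtain L where "\<forall>\<^sub>F w in base_step_filter z. \<bar>h (fst w)\<bar> \<noteq> \<infinity> \<and> \<bar>h (fst w + snd w *\<^sub>R u)\<bar> \<noteq> \<infinity> \<and>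
      \<bar>increment h u w\<bar> \<le> L * norm u * snd w"
    using eventually_increment_bound[OF assms] by blast
  then show "\<forall>\<^sub>F w in base_step_filter z.
      (case w of (z', t) \<Rightarrow> (h (z' + t *\<^sub>R u) - h z') / ereal t) = ereal (increment h u w / snd w)"
    using eventually_step_pos
  proof eventually_elim
    case (elim w)
    then obtain a b where "h (fst w) = ereal a" "h (fst w + snd w *\<^sub>R u) = ereal b"
      by (metis ereal_real')
    then show ?case using elim by (auto simp: case_prod_beta)
  qed
qed

text \<open>Clearing the denominator reduces the calculus of the upper limit to eventual real
  inequalities, which compose with limits of filters.\<close>

lemma clarke_deriv_le_iff:
  assumes "locally_lipschitz_at h z"
  shows "clarke_deriv h z u \<le> ereal c \<longleftrightarrow>
    (\<forall>e>0. \<forall>\<^sub>F w in base_step_filter z. increment h u w \<le> (c + e) * snd w)"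
  unfolding clarke_deriv_eq_Limsup_real[OF assms] Limsup_le_iff
proof (intro iffI allI impI)
  fix e :: real
  assume ev: "\<forall>y>ereal c. \<forall>\<^sub>F w in base_step_filter z. ereal (increment h u w / snd w) < y" and e: "0 < e"
  then have "ereal c < ereal (c + e)" by simp
  with ev have "\<forall>\<^sub>F w in base_step_filter z. ereal (increment h u w / snd w) < ereal (c + e)"
    by blast
  then show "\<forall>\<^sub>F w in base_step_filter z. increment h u w \<le> (c + e) * snd w"
    using eventually_step_pos by eventually_elim (simp add: pos_divide_less_eq)
next
  fix y :: ereal
  assume ev: "\<forall>e>0. \<forall>\<^sub>F w in base_step_filter z. increment h u w \<le> (c + e) * snd w" and y: "ereal c < y"
  \<comment> \<open>Since \<open>y\<close> may be infinite, a real \<open>b\<close> below it is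
    inserted; the slack is \<open>b - c\<close>.\<close>
  obtain b where b: "ereal c < ereal b" "ereal b < y"
    using ereal_dense2[OF y] by auto
  have "\<forall>\<^sub>F w in base_step_filter z. increment h u w \<le> (c + (b - c)) * snd w"
    using ev b(1) by (auto dest: spec[of _ "b - c"])
  then show "\<forall>\<^sub>F w in base_step_filter z. ereal (increment h u w / snd w) < y"
    using eventually_step_pos
  proof eventually_elim
    case (elim w)
    then have "ereal (increment h u w / snd w) \<le> ereal b"
      by (simp add: pos_divide_le_eq)
    then show ?case using b(2) by (rule le_less_trans)
  qed
qed

text \<open>Only meaningful where \<open>h\<close> is locally Lipschitz: an infinite derivative is sent to \<open>0\<close>.\<close>

definition clarke_dir :: "('a::real_normed_vector \<Rightarrow> ereal) \<Rightarrow> 'a \<Rightarrow> 'a \<Rightarrow> real"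
  where "clarke_dir h z u = real_of_ereal (clarke_deriv h z u)"

lemma clarke_deriv_bounded:
  assumes "locally_lipschitz_at h z"
  obtains L where "\<And>u. \<bar>clarke_deriv h z u\<bar> \<le> ereal (L * norm u)"
proof -
  obtain L where L: "0 < L"
    and bound: "\<forall>u. \<forall>\<^sub>F w in base_step_filter z. \<bar>h (fst w)\<bar> \<noteq> \<infinity> \<and> \<bar>h (fst w + snd w *\<^sub>R u)\<bar> \<noteq> \<infinity> \<and>
      \<bar>increment h u w\<bar> \<le> L * norm u * snd w"
    using eventually_increment_bound[OF assms] by blast
  show thesis
  proof
    fix u
    have ev: "\<forall>\<^sub>F w in base_step_filter z.
        increment h u w / snd w \<le> L * norm u \<and> - (L * norm u) \<le> increment h u w / snd w"
      using spec[OF bound, of u] eventually_step_pos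
      by eventually_elim (simp add: pos_divide_le_eq pos_le_divide_eq abs_le_iff)
    have "clarke_deriv h z u \<le> ereal (L * norm u)"
      unfolding clarke_deriv_eq_Limsup_real[OF assms]
      by (rule Limsup_bounded) (use ev in eventually_elim, auto)
    moreover have "ereal (- (L * norm u)) \<le> clarke_deriv h z u"
      unfolding clarke_deriv_eq_Limsup_real[OF assms]
      by (rule le_Limsup[OF base_step_filter_neq_bot]) (use ev in eventually_elim, auto)
    ultimately show "\<bar>clarke_deriv h z u\<bar> \<le> ereal (L * norm u)"
      by (cases "clarke_deriv h z u") auto
  qed
qed

lemma ereal_clarke_dir:
  assumes "locally_lipschitz_at h z"
  shows "ereal (clarke_dir h z u) = clarke_deriv h z u"
proof -
  obtain L where "\<bar>clarke_deriv h z u\<bar> \<le> ereal (L * norm u)"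
    using clarke_deriv_bounded[OF assms] by metis
  then show ?thesis
    unfolding clarke_dir_def by (cases "clarke_deriv h z u") auto
qed

lemma clarke_dir_bounded:
  assumes "locally_lipschitz_at h z"
  obtains L where "\<And>u. clarke_dir h z u \<le> L * norm u"
proof -
  obtain L where "\<And>u. \<bar>clarke_deriv h z u\<bar> \<le> ereal (L * norm u)"
    using clarke_deriv_bounded[OF assms] by metis
  then have "clarke_dir h z u \<le> L * norm u" for u
    using ereal_clarke_dir[OF assms, of u, symmetric] by (metis abs_ereal.simps(1) abs_le_D1 ereal_less_eq(3))
  then show thesis by (rule that)
qed

lemma clarke_dir_le_iff:
  assumes "locally_lipschitz_at h z"
  shows "clarke_dir h z u \<le> c \<longleftrightarrow>
    (\<forall>e>0. \<forall>\<^sub>F w in base_step_filter z. increment h u w \<le> (c + e) * snd w)"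
  unfolding clarke_deriv_le_iff[OF assms, symmetric] ereal_clarke_dir[OF assms, symmetric]
  by (rule ereal_less_eq(3)[symmetric])

lemma eventually_increment_le:
  assumes "locally_lipschitz_at h z" "0 < e"
  shows "\<forall>\<^sub>F w in base_step_filter z. increment h u w \<le> (clarke_dir h z u + e) * snd w"
  using clarke_dir_le_iff[OF assms(1), of u "clarke_dir h z u"] assms(2) by simp

lemma mem_clarke_subdiff_iff:
  assumes "locally_lipschitz_at h z"
  shows "zs \<in> clarke_subdiff h z \<longleftrightarrow> (\<forall>u. blinfun_apply zs u \<le> clarke_dir h z u)"
  by (simp add: clarke_subdiff_def flip: ereal_clarke_dir[OF assms])

text \<open>A step along \<open>u + v\<close> is a step along \<open>u\<close> followed by one along
  \<open>v\<close> from the shifted base point; a step along \<open>c *\<^sub>R u\<close> is a step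
  along \<open>u\<close> of rescaled length. Both substitutions respect the filter.\<close>

lemma sublinear_clarke_dir:
  assumes h: "locally_lipschitz_at h z"
  shows "sublinear (clarke_dir h z)"
proof (rule sublinearI)
  fix u v
  have "\<forall>\<^sub>F w in base_step_filter z.
      increment h (u + v) w \<le> (clarke_dir h z u + clarke_dir h z v + e) * snd w" if e: "0 < e" for e
  proof -
    have "filterlim (\<lambda>w. (fst w + snd w *\<^sub>R u, snd w)) (base_step_filter z) (base_step_filter z)"
      by (intro filterlim_Pair filterlim_base_shift filterlim_snd)
    note shifted = eventually_compose_filterlim[OF eventually_increment_le[OF h, of "e / 2" v] this]
    show ?thesis
      using eventually_increment_le[OF h half_gt_zero[OF e], of u] shifted[OF half_gt_zero[OF e]]
      by eventually_elim (simp add: algebra_simps)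
  qed
  then show "clarke_dir h z (u + v) \<le> clarke_dir h z u + clarke_dir h z v"
    by (simp add: clarke_dir_le_iff[OF h])
next
  fix c u assume c: "(0::real) < c"
  have "\<forall>\<^sub>F w in base_step_filter z. increment h (c *\<^sub>R u) w \<le> (c * clarke_dir h z u + e) * snd w"
    if e: "0 < e" for e
  proof -
    have "filterlim (\<lambda>w. (fst w, c * snd w)) (base_step_filter z) (base_step_filter z)"
      using c by (intro filterlim_Pair filterlim_fst filterlim_times_pos[OF filterlim_snd]) auto
    from eventually_compose_filterlim[OF eventually_increment_le[OF h divide_pos_pos[OF e c], of u] this]
    show ?thesis
    proof eventually_elim
      case (elim w)
      have "(clarke_dir h z u + e / c) * (c * snd w) = (c * clarke_dir h z u + e) * snd w"
        using c by (simp add: field_simps)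
      with elim show ?case by (simp only: fst_conv snd_conv scaleR_scaleR mult.commute[of "snd w" c])
    qed
  qed
  then show "clarke_dir h z (c *\<^sub>R u) \<le> c * clarke_dir h z u"
    by (simp add: clarke_dir_le_iff[OF h])
next
  show "clarke_dir h z 0 \<le> 0"
    unfolding clarke_dir_le_iff[OF h]
    by (intro allI impI eventually_mono[OF eventually_step_pos]) simp
qed

text \<open>If the lower bound failed eventually for some \<open>k\<close>, the derivative would be
  at most \<open>c - inverse (real (Suc k))\<close>. So it holds frequently for each
  \<open>k\<close>, and \<open>frequently_sequence\<close> selects the pairs.\<close>

lemma clarke_dir_sequence:
  assumes h: "locally_lipschitz_at h z" and c: "c \<le> clarke_dir h z u"
  obtains zk tk where "zk \<longlonglongrightarrow> z" "tk \<longlonglongrightarrow> 0" "\<And>k. 0 < tk k"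
    "\<And>k::nat. (c - inverse (real (Suc k))) * tk k \<le> increment h u (zk k, tk k)"
proof -
  have "\<exists>\<^sub>F w in base_step_filter z. (c - inverse (real (Suc k))) * snd w \<le> increment h u w" for k
  proof (rule ccontr)
    define e where "e = inverse (real (Suc k))"
    have e: "0 < e" by (simp add: e_def)
    assume "\<not> ?thesis"
    then have "\<forall>\<^sub>F w in base_step_filter z. increment h u w < (c - e) * snd w"
      by (simp add: not_frequently not_le e_def)
    then have "\<forall>\<^sub>F w in base_step_filter z. increment h u w \<le> (c - e + d) * snd w" if "0 < d" for d
      using eventually_step_pos
    proof eventually_elim
      case (elim w)
      have "(c - e) * snd w \<le> (c - e + d) * snd w"
        using that elim by (intro mult_right_mono) auto
      then show ?case using elim(1) by linarith
    qed
    then have "clarke_dir h z u \<le> c - e"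
      by (simp add: clarke_dir_le_iff[OF h])
    then show False using c e by simp
  qed
  then show thesis
  proof (rule frequently_sequence)
    fix zk tk
    assume "zk \<longlonglongrightarrow> z" "tk \<longlonglongrightarrow> 0" "\<And>k. 0 < tk k"
      "\<And>k. (c - inverse (real (Suc k))) * snd (zk k, tk k) \<le> increment h u (zk k, tk k)"
    then show thesis using that[of zk tk] by simp
  qed
qed

lemma bounded_linear_of_le_norm:
  fixes l :: "'a::real_normed_vector \<Rightarrow> real"
  assumes "linear l" "\<And>u. l u \<le> L * norm u"
  shows "bounded_linear l"
proof -
  have "- l x \<le> L * norm x" for x
    using assms(2)[of "- x"] unfolding linear_neg[OF assms(1)] by simp
  then have "norm (l x) \<le> norm x * L" for x
    unfolding real_norm_def abs_le_iff mult.commute[of _ L] using assms(2) by blast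
  then show ?thesis
    by (rule bounded_linear_intro[OF linear_add[OF assms(1)] linear_scale[OF assms(1)]])
qed

section \<open>The distance penalty of a set-valued mapping\<close>

lemma infdist_lessE:
  assumes "infdist x A < c" "A \<noteq> {}"
  obtains a where "a \<in> A" "dist x a < c"
  using assms by (metis cINF_greatest infdist_notempty not_le)

lemma aubin_propertyE:
  fixes F :: "'a::real_normed_vector \<Rightarrow> 'b::real_normed_vector set"
  assumes "aubin_property F (a, b)"
  obtains l s where "0 \<le> l" "0 < s"
    "\<And>x x' y. \<lbrakk>dist a x < s; dist a x' < s; dist b y < s; y \<in> F x\<rbrakk> \<Longrightarrow> \<exists>y'\<in>F x'. dist y y' \<le> l * dist x x'"
proof -
  obtain l U V where l: "0 \<le> l" and U: "open U" "a \<in> U" and V: "open V" "b \<in> V"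
    and sub: "\<And>x x'. x \<in> U \<Longrightarrow> x' \<in> U \<Longrightarrow>
      F x \<inter> V \<subseteq> {y + (l * norm (x - x')) *\<^sub>R b | y b. y \<in> F x' \<and> b \<in> cball 0 1}"
    using assms unfolding aubin_property_def by auto
  obtain s1 s2 where s: "0 < s1" "ball a s1 \<subseteq> U" "0 < s2" "ball b s2 \<subseteq> V"
    using U V openE by metis
  show thesis
  proof (rule that[of l "min s1 s2"])
    fix x x' y
    assume x: "dist a x < min s1 s2" "dist a x' < min s1 s2" and y: "dist b y < min s1 s2" "y \<in> F x"
    have "x \<in> U" "x' \<in> U" "y \<in> F x \<inter> V"
      using x y s by auto
    then obtain y' e where y': "y = y' + (l * norm (x - x')) *\<^sub>R e" "y' \<in> F x'" "norm e \<le> 1"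
      using sub[of x x'] by auto
    have "dist y y' = l * norm (x - x') * norm e"
      using l by (simp add: y'(1) dist_norm)
    also have "\<dots> \<le> l * dist x x'"
      using l y'(3) by (simp add: dist_norm mult_left_le)
    finally show "\<exists>y'\<in>F x'. dist y y' \<le> l * dist x x'"
      using y'(2) by blast
  qed (use l s in auto)
qed

text \<open>A near projection \<open>w\<close> of \<open>y\<close> onto \<open>F x\<close> stays in
  the Aubin neighborhood and is carried to a point of \<open>F x'\<close> at distance at most
  \<open>l * dist x x'\<close>; the triangle inequality does the rest.\<close>

lemma aubin_infdist_lipschitz:
  fixes F :: "'a::real_normed_vector \<Rightarrow> 'b::real_normed_vector set"
  assumes aubin: "aubin_property F (a, b)" and b: "b \<in> F a" and ne: "\<And>x. F x \<noteq> {}"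
  obtains l r where "0 \<le> l" "0 < r"
    "\<And>x y x' y'. \<lbrakk>dist a x < r; dist b y < r; dist a x' < r\<rbrakk> \<Longrightarrow>
      infdist y' (F x') \<le> infdist y (F x) + l * dist x x' + dist y y'"
proof -
  obtain l s where l: "0 \<le> l" and s: "0 < s"
    and step: "\<And>x x' y. \<lbrakk>dist a x < s; dist a x' < s; dist b y < s; y \<in> F x\<rbrakk> \<Longrightarrow>
      \<exists>y'\<in>F x'. dist y y' \<le> l * dist x x'"
    using aubin_propertyE[OF aubin] by metis
  \<comment> \<open>With \<open>dist b y < r\<close>, distance from \<open>y\<close> to
    \<open>F x\<close> at most \<open>r + l * r\<close>, and error \<open>e < r\<close>, the near
    projection lies within \<open>l * r + 3 * r < s\<close> of \<open>b\<close>.\<close>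
  define r where "r = s / (l + 4)"
  have r: "0 < r" using l s by (simp add: r_def)
  have rs: "l * r + 4 * r = s" using l by (simp add: r_def flip: add_divide_distrib distrib_right)
  have lr: "0 \<le> l * r" using l r by simp
  show thesis
  proof (rule that[OF l r])
    fix x y x' y'
    assume x: "dist a x < r" and y: "dist b y < r" and x': "dist a x' < r"
    obtain y0 where y0: "y0 \<in> F x" "dist b y0 \<le> l * dist a x"
      using step[of a x b] x rs r lr s b by auto
    have "l * dist a x \<le> l * r" using l x by (simp add: mult_left_mono)
    then have near: "infdist y (F x) \<le> r + l * r"
      using infdist_le[OF y0(1), of y] y0(2) y dist_triangle[of y y0 b] by (simp add: dist_commute)
    have "infdist y' (F x') \<le> infdist y (F x) + l * dist x x' + dist y y' + e" if e: "0 < e" "e < r" for e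
    proof -
      obtain w where w: "w \<in> F x" "dist y w < infdist y (F x) + e"
        using infdist_lessE[of y "F x" "infdist y (F x) + e"] ne e by auto
      have "dist b w < s"
        using dist_triangle[of b w y] y w(2) near e rs r by linarith
      then obtain w' where w': "w' \<in> F x'" "dist w w' \<le> l * dist x x'"
        using step[of x x' w] x x' w(1) rs r lr by auto
      show ?thesis
        using infdist_le[OF w'(1), of y'] dist_triangle[of y' w' y] dist_triangle[of y w' w] w(2) w'(2)
        by (simp add: dist_commute)
    qed
    note approx = this
    \<comment> \<open>The approximate estimate holds for errors below \<open>r\<close> only, so
      larger ones are cut to \<open>r / 2\<close>.\<close>
    show "infdist y' (F x') \<le> infdist y (F x) + l * dist x x' + dist y y'"
    proof (rule field_le_epsilon)
      fix e :: real
      assume "0 < e"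
      then show "infdist y' (F x') \<le> infdist y (F x) + l * dist x x' + dist y y' + e"
        using approx[of "min e (r / 2)"] r by linarith
    qed
  qed
qed

text \<open>With \<open>L\<close> a Lipschitz constant of \<open>f\<close> in its second argument
  this is an exact penalty for the constraint. Extended real values let the Clarke notions apply
  directly.\<close>

definition graph_penalty ::
  "real \<Rightarrow> ('a::real_normed_vector \<Rightarrow> 'b::real_normed_vector set) \<Rightarrow> 'a \<times> 'b \<Rightarrow> ereal"
  where "graph_penalty L F w = ereal (L * infdist (snd w) (F (fst w)))"

lemma locally_lipschitz_graph_penalty:
  fixes F :: "'a::real_normed_vector \<Rightarrow> 'b::real_normed_vector set"
  assumes aubin: "aubin_property F (a, b)" and b: "b \<in> F a" and ne: "\<And>x. F x \<noteq> {}" and L: "0 < L"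
  shows "locally_lipschitz_at (graph_penalty L F) (a, b)"
proof -
  obtain l r where l: "0 \<le> l" and r: "0 < r"
    and lip: "\<And>x y x' y'. \<lbrakk>dist a x < r; dist b y < r; dist a x' < r\<rbrakk> \<Longrightarrow>
      infdist y' (F x') \<le> infdist y (F x) + l * dist x x' + dist y y'"
    using aubin_infdist_lipschitz[OF aubin b ne] by metis
  let ?U = "ball a r \<times> ball b r"
  have "L * infdist (snd w) (F (fst w)) \<le> L * infdist (snd v) (F (fst v)) + L * (l + 1) * dist v w"
    if "v \<in> ?U" "w \<in> ?U" for v w
  proof -
    have "infdist (snd w) (F (fst w))
        \<le> infdist (snd v) (F (fst v)) + l * dist (fst v) (fst w) + dist (snd v) (snd w)"
      using that by (intro lip) auto
    also have "\<dots> \<le> infdist (snd v) (F (fst v)) + l * dist v w + dist v w"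
      using l by (intro add_mono mult_left_mono dist_fst_le dist_snd_le order_refl)
    finally have "L * infdist (snd w) (F (fst w)) \<le> L * (infdist (snd v) (F (fst v)) + l * dist v w + dist v w)"
      using L by (intro mult_left_mono) auto
    then show ?thesis by (simp add: algebra_simps)
  qed
  \<comment> \<open>Exchanging \<open>v\<close> and \<open>w\<close> in the one-sided estimate gives
    the absolute value.\<close>
  then have "\<bar>L * infdist (snd v) (F (fst v)) - L * infdist (snd w) (F (fst w))\<bar> \<le> L * (l + 1) * dist v w"
    if "v \<in> ?U" "w \<in> ?U" for v w
    unfolding abs_le_iff using that dist_commute[of w v] by (smt (verit))
  then have "(L * (l + 1))-lipschitz_on ?U (\<lambda>w. real_of_ereal (graph_penalty L F w))"
    using L l by (intro lipschitz_onI) (auto simp: graph_penalty_def dist_real_def)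
  then have "ext_lipschitz_on (L * (l + 1)) ?U (graph_penalty L F)"
    using L l by (simp add: ext_lipschitz_on_def) (simp add: graph_penalty_def)
  then show ?thesis
    unfolding locally_lipschitz_at_def using r
    by (intro exI[of _ "L * (l + 1)"] exI[of _ ?U]) (simp add: open_Times)
qed

text \<open>Base points realising the derivative may lie off the graph, so they are moved to
  \<open>wk\<close> on it by changing the second component only. At fixed first component the
  penalty has the exact constant \<open>L\<close>, so the cost of the move is cancelled by the
  penalty at \<open>zk\<close> up to a small error; the general constant \<open>K\<close> would be
  too coarse.\<close>

lemma clarke_dir_graph_penalty_le_0:
  fixes F :: "'a::real_normed_vector \<Rightarrow> 'b::real_normed_vector set"
  assumes h: "locally_lipschitz_at (graph_penalty L F) (a, b)" and b: "b \<in> F a"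
    and ne: "\<And>x. F x \<noteq> {}" and L: "0 < L" and u: "u \<in> clarke_tangent (gph F) (a, b)"
  shows "clarke_dir (graph_penalty L F) (a, b) u \<le> 0"
proof (rule ccontr)
  define \<rho> where "\<rho> w = L * infdist (snd w) (F (fst w))" for w :: "'a \<times> 'b"
  have \<rho>: "real_of_ereal (graph_penalty L F w) = \<rho> w" for w
    by (simp add: \<rho>_def graph_penalty_def)
  have \<rho>_ge: "0 \<le> \<rho> w" for w
    using L by (simp add: \<rho>_def infdist_nonneg)
  define c where "c = clarke_dir (graph_penalty L F) (a, b) u"
  assume "\<not> clarke_dir (graph_penalty L F) (a, b) u \<le> 0"
  then have c: "0 < c" by (simp add: c_def)
  \<comment> \<open>Three errors of size \<open>d\<close> occur: from the near projection, from the
    tangent sequence and from \<open>inverse (real (Suc k))\<close>. Their sum stays below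
    \<open>c\<close>.\<close>
  define d where "d = c / 4"
  have d: "0 < d" using c by (simp add: d_def)
  obtain K U where K: "0 < K" and U: "open U" "(a, b) \<in> U"
    and lip: "\<And>v w. v \<in> U \<Longrightarrow> w \<in> U \<Longrightarrow> \<bar>\<rho> v - \<rho> w\<bar> \<le> K * dist v w"
    using locally_lipschitz_atE[OF h] unfolding \<rho> by metis
  obtain zk tk where z: "zk \<longlonglongrightarrow> (a, b)" and t: "tk \<longlonglongrightarrow> 0" "\<And>k. 0 < tk k"
    and inc: "\<And>k. (c - inverse (real (Suc k))) * tk k \<le> \<rho> (zk k + tk k *\<^sub>R u) - \<rho> (zk k)"
    using clarke_dir_sequence[OF h order_refl[of "clarke_dir (graph_penalty L F) (a, b) u"]]
    unfolding \<rho> c_def fst_conv snd_conv by metis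
  \<comment> \<open>The projection error must be proportional to \<open>tk k\<close> to survive
    division by the step.\<close>
  have "\<exists>y\<in>F (fst (zk k)). L * dist (snd (zk k)) y \<le> \<rho> (zk k) + d * tk k" for k
  proof -
    have "infdist (snd (zk k)) (F (fst (zk k))) < infdist (snd (zk k)) (F (fst (zk k))) + d * tk k / L"
      using d t(2) L by simp
    then obtain y where "y \<in> F (fst (zk k))"
      "dist (snd (zk k)) y < infdist (snd (zk k)) (F (fst (zk k))) + d * tk k / L"
      using infdist_lessE ne by metis
    then show ?thesis
      using L by (intro bexI[of _ y]) (auto simp: \<rho>_def field_simps dest: less_imp_le)
  qed
  then obtain yk where yk: "\<And>k. yk k \<in> F (fst (zk k))"
    "\<And>k. L * dist (snd (zk k)) (yk k) \<le> \<rho> (zk k) + d * tk k" by metis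
  define wk where "wk k = (fst (zk k), yk k)" for k
  have dist_wz: "dist (wk k) (zk k) = dist (snd (zk k)) (yk k)" for k
    by (cases "zk k") (simp add: wk_def dist_Pair_Pair dist_commute)
  \<comment> \<open>As \<open>b \<in> F a\<close>, the penalty vanishes at \<open>(a, b)\<close> and
    hence tends to zero along \<open>zk\<close>; this forces the near projections \<open>wk\<close>
    to converge to \<open>(a, b)\<close> too.\<close>
  have \<rho>_lim: "(\<lambda>k. \<rho> (zk k)) \<longlonglongrightarrow> 0"
  proof (rule Lim_null_comparison[of _ "\<lambda>k. K * dist (zk k) (a, b)"])
    have \<rho>0: "\<rho> (a, b) = 0" using b by (simp add: \<rho>_def)
    show "\<forall>\<^sub>F k in sequentially. norm (\<rho> (zk k)) \<le> K * dist (zk k) (a, b)"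
      using topological_tendstoD[OF z U] by eventually_elim (use lip[OF _ U(2)] in \<open>simp only: \<rho>0 real_norm_def diff_0_right\<close>)
    show "(\<lambda>k. K * dist (zk k) (a, b)) \<longlonglongrightarrow> 0"
      using tendsto_mult_right_zero[OF z[unfolded tendsto_dist_iff[of zk]]] .
  qed
  have dist_lim: "(\<lambda>k. dist (wk k) (zk k)) \<longlonglongrightarrow> 0"
  proof (rule Lim_null_comparison[of _ "\<lambda>k. (\<rho> (zk k) + d * tk k) / L"])
    show "\<forall>\<^sub>F k in sequentially. norm (dist (wk k) (zk k)) \<le> (\<rho> (zk k) + d * tk k) / L"
      using yk(2) L by (auto simp: dist_wz field_simps)
    have "(\<lambda>k. (\<rho> (zk k) + d * tk k) / L) \<longlonglongrightarrow> (0 + d * 0) / L"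
      using L by (intro tendsto_intros \<rho>_lim t) auto
    then show "(\<lambda>k. (\<rho> (zk k) + d * tk k) / L) \<longlonglongrightarrow> 0" by simp
  qed
  have w: "wk \<longlonglongrightarrow> (a, b)"
    using Lim_transform[OF z, of wk] dist_lim by (simp add: dist_norm tendsto_norm_zero_iff norm_minus_commute)
  have "\<forall>k. wk k \<in> gph F" using yk(1) by (simp add: gph_def wk_def)
  then obtain uk where uk: "uk \<longlonglongrightarrow> u" "\<And>k. wk k + tk k *\<^sub>R uk k \<in> gph F"
    using u w t unfolding clarke_tangent_def by blast
  have near1: "\<forall>\<^sub>F k in sequentially. wk k + tk k *\<^sub>R uk k \<in> U"
  proof (rule topological_tendstoD[OF _ U])
    show "(\<lambda>k. wk k + tk k *\<^sub>R uk k) \<longlonglongrightarrow> (a, b)"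
      using tendsto_add[OF w tendsto_scaleR[OF t(1) uk(1)]] by simp
  qed
  have near2: "\<forall>\<^sub>F k in sequentially. wk k + tk k *\<^sub>R u \<in> U"
  proof (rule topological_tendstoD[OF _ U])
    show "(\<lambda>k. wk k + tk k *\<^sub>R u) \<longlonglongrightarrow> (a, b)"
      using tendsto_add[OF w tendsto_scaleR[OF t(1) tendsto_const]] by simp
  qed
  have "(\<lambda>k. K * dist (uk k) u) \<longlonglongrightarrow> 0"
    using tendsto_mult_right_zero[OF uk(1)[unfolded tendsto_dist_iff[of uk]]] .
  then have near3: "\<forall>\<^sub>F k in sequentially. K * dist (uk k) u < d"
    using d by (rule order_tendstoD)
  have near4: "\<forall>\<^sub>F k in sequentially. inverse (real (Suc k)) < d"
    using LIMSEQ_inverse_real_of_nat d by (rule order_tendstoD)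
  have "\<forall>\<^sub>F k in sequentially. False"
    using near1 near2 near3 near4
  proof eventually_elim
    case (elim k)
    \<comment> \<open>The tangent sequence keeps the step on the graph; replacing
      \<open>uk k\<close> by \<open>u\<close> costs at most \<open>K * dist (uk k) u\<close> per
      unit step.\<close>
    have "\<rho> (wk k + tk k *\<^sub>R uk k) = 0"
      using uk(2)[of k] by (auto simp: \<rho>_def gph_def case_prod_beta)
    then have "\<rho> (wk k + tk k *\<^sub>R u) \<le> K * dist (wk k + tk k *\<^sub>R u) (wk k + tk k *\<^sub>R uk k)"
      using lip[OF elim(2,1)] by simp
    also have "\<dots> = tk k * (K * dist (uk k) u)"
      using t(2)[of k] by (simp add: dist_norm norm_minus_commute flip: scaleR_diff_right)
    also have "\<dots> \<le> tk k * d"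
      using elim(3) t(2)[of k] by (intro mult_left_mono) auto
    finally have 1: "\<rho> (wk k + tk k *\<^sub>R u) \<le> tk k * d" .
    \<comment> \<open>The points \<open>zk k\<close> and \<open>wk k\<close> share their first
      component, so both distances are to the same set.\<close>
    have "infdist (snd (zk k + tk k *\<^sub>R u)) (F (fst (zk k + tk k *\<^sub>R u)))
        \<le> infdist (snd (wk k + tk k *\<^sub>R u)) (F (fst (zk k + tk k *\<^sub>R u)))
          + dist (snd (zk k + tk k *\<^sub>R u)) (snd (wk k + tk k *\<^sub>R u))"
      by (rule infdist_triangle)
    also have "dist (snd (zk k + tk k *\<^sub>R u)) (snd (wk k + tk k *\<^sub>R u)) = dist (snd (zk k)) (yk k)"
      by (simp add: wk_def)
    finally have "\<rho> (zk k + tk k *\<^sub>R u) \<le> \<rho> (wk k + tk k *\<^sub>R u) + L * dist (snd (zk k)) (yk k)"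
      using L by (simp add: \<rho>_def wk_def flip: distrib_left)
    also have "\<dots> \<le> tk k * d + (\<rho> (zk k) + d * tk k)"
      using 1 yk(2) by (rule add_mono)
    finally have "(c - inverse (real (Suc k))) * tk k \<le> (2 * d) * tk k"
      using inc[of k] by (simp add: algebra_simps)
    then have "c - inverse (real (Suc k)) \<le> 2 * d"
      using t(2)[of k] by simp
    then show False using elim(4) d unfolding d_def by linarith
  qed
  then show False by simp
qed

text \<open>Each feasible \<open>y'\<close> gives a bound by \<open>f (x, y')\<close>, which exceeds
  \<open>f (x, y)\<close> by at most \<open>L * dist y y'\<close>; the infimum over
  \<open>y'\<close> turns this into the penalty.\<close>

lemma marginal_le_penalised:
  fixes F :: "'a::real_normed_vector \<Rightarrow> 'b::real_normed_vector set"
  assumes ne: "F x \<noteq> {}" and f: "ext_lipschitz_on L UNIV (\<lambda>y. f (x, y))"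
    and fin: "\<bar>marginal f F x\<bar> \<noteq> \<infinity>"
  shows "real_of_ereal (marginal f F x) \<le>
    real_of_ereal (f (x, y)) + real_of_ereal (graph_penalty L F (x, y))"
proof -
  have L: "0 < L" using f by (simp add: ext_lipschitz_on_def)
  have "(real_of_ereal (marginal f F x) - real_of_ereal (f (x, y))) / L \<le> infdist y (F x)"
    unfolding infdist_notempty[OF ne]
  proof (rule cINF_greatest[OF ne])
    fix y' assume y': "y' \<in> F x"
    have "marginal f F x \<le> f (x, y')"
      unfolding marginal_def using y' by (rule INF_lower)
    moreover have "\<bar>f (x, y')\<bar> \<noteq> \<infinity>"
      using f by (simp add: ext_lipschitz_on_def)
    ultimately have "real_of_ereal (marginal f F x) \<le> real_of_ereal (f (x, y'))"
      using fin by (cases "marginal f F x"; cases "f (x, y')") auto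
    moreover have "dist (real_of_ereal (f (x, y'))) (real_of_ereal (f (x, y))) \<le> L * dist y' y"
      using f by (auto simp: ext_lipschitz_on_def dest: lipschitz_onD)
    ultimately show "(real_of_ereal (marginal f F x) - real_of_ereal (f (x, y))) / L \<le> dist y y'"
      using L by (simp add: pos_divide_le_eq dist_real_def dist_commute mult.commute)
  qed
  then show ?thesis
    using L by (simp add: graph_penalty_def field_simps)
qed

section \<open>The marginal function\<close>

text \<open>The order of quantifiers matters: \<open>b\<close> is a cluster point of solutions along a sequence realising
  the directional derivative of the marginal function in direction \<open>u\<close>, so it serves all \<open>v\<close> at once.\<close>

lemma clarke_dir_marginal_le:
  fixes F :: "'a::real_normed_vector \<Rightarrow> 'b::real_normed_vector set"
    and f :: "'a \<times> 'b \<Rightarrow> ereal"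
  assumes ne: "\<And>x. F x \<noteq> {}" and L: "0 < L" and U: "open U" "a \<in> U"
    and lip: "\<And>x. x \<in> U \<Longrightarrow> ext_lipschitz_on L UNIV (\<lambda>y. f (x, y))"
    and f: "\<And>y. y \<in> solution_map f F a \<Longrightarrow> locally_lipschitz_at f (a, y)"
    and pen: "\<And>y. y \<in> solution_map f F a \<Longrightarrow> locally_lipschitz_at (graph_penalty L F) (a, y)"
    and \<phi>: "locally_lipschitz_at (marginal f F) a"
    and semicompact: "inner_semicompact_at (solution_map f F) a"
    and closed: "closed_mapping_at (solution_map f F) a"
    and \<gamma>: "\<gamma> \<le> clarke_dir (marginal f F) a u"
  obtains b where "b \<in> solution_map f F a"
    "\<And>v. \<gamma> \<le> clarke_dir f (a, b) (u, v) + clarke_dir (graph_penalty L F) (a, b) (u, v)"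
proof -
  let ?S = "solution_map f F" and ?\<phi> = "marginal f F" and ?\<rho> = "graph_penalty L F"
  obtain xk tk where x: "xk \<longlonglongrightarrow> a" and t: "tk \<longlonglongrightarrow> 0" "\<And>k. 0 < tk k"
    and inc: "\<And>k. (\<gamma> - inverse (real (Suc k))) * tk k \<le> increment ?\<phi> u (xk k, tk k)"
    using clarke_dir_sequence[OF \<phi> \<gamma>] by metis
  obtain yk r b where yk: "\<forall>\<^sub>F k in sequentially. yk k \<in> ?S (xk k)"
    and r: "strict_mono r" and b: "(yk \<circ> r) \<longlonglongrightarrow> b"
    using semicompact x unfolding inner_semicompact_at_def by blast
  obtain N where N: "\<And>k. N \<le> k \<Longrightarrow> yk k \<in> ?S (xk k)"
    using yk by (auto simp: eventually_sequentially)
  \<comment> \<open>The solutions exist only from index \<open>N\<close> on, while closedness of the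
    mapping asks for graph points at every index; the shift supplies them.\<close>
  define s where "s k = r (k + N)" for k
  have s: "strict_mono s"
    using r by (simp add: s_def strict_mono_def)
  have "N \<le> s k" for k
    using seq_suble[OF r, of "k + N"] by (simp add: s_def)
  then have sol: "yk (s k) \<in> ?S (xk (s k))" for k
    by (rule N)
  have xs: "(\<lambda>k. xk (s k)) \<longlonglongrightarrow> a" and ts: "(\<lambda>k. tk (s k)) \<longlonglongrightarrow> 0"
    using LIMSEQ_subseq_LIMSEQ[OF x s] LIMSEQ_subseq_LIMSEQ[OF t(1) s] by (simp_all add: comp_def)
  have ys: "(\<lambda>k. yk (s k)) \<longlonglongrightarrow> b"
    using LIMSEQ_ignore_initial_segment[OF b, of N] by (simp add: comp_def s_def)
  have "(a, b) \<in> gph ?S"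
    using closed[unfolded closed_mapping_at_def, THEN conjunct2, rule_format,
        of "\<lambda>k. xk (s k)" "\<lambda>k. yk (s k)" b] sol tendsto_Pair[OF xs ys]
    by (simp add: gph_def)
  then have bS: "b \<in> ?S a" by (simp add: gph_def)
  have base: "filterlim (\<lambda>k. (xk (s k), tk (s k))) (base_step_filter a) sequentially"
    and base2: "filterlim (\<lambda>k. ((xk (s k), yk (s k)), tk (s k))) (base_step_filter (a, b)) sequentially"
    using t(2) by (auto intro!: filterlim_Pair xs tendsto_Pair ys tendsto_imp_filterlim_at_right[OF ts])
  obtain V where V: "open V" "a \<in> V" "\<And>x. x \<in> V \<Longrightarrow> \<bar>?\<phi> x\<bar> \<noteq> \<infinity>"
    using locally_lipschitz_atE[OF \<phi>] by metis
  have UV: "open (U \<inter> V)" "a \<in> U \<inter> V" using U V by auto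
  show thesis
  proof (rule that[OF bS])
    fix v
    let ?d = "clarke_dir f (a, b) (u, v) + clarke_dir ?\<rho> (a, b) (u, v)"
    show "\<gamma> \<le> ?d"
    proof (rule field_le_epsilon)
      fix e :: real assume "0 < e"
      \<comment> \<open>The three shares go to \<open>inverse (real (Suc (s k)))\<close>, the
        increment of \<open>f\<close> and that of the penalty.\<close>
      then have e: "0 < e / 3" by simp
      have "(\<lambda>k. inverse (real (Suc (s k)))) \<longlonglongrightarrow> 0"
        using LIMSEQ_subseq_LIMSEQ[OF LIMSEQ_inverse_real_of_nat s] by (simp add: comp_def)
      then have ev1: "\<forall>\<^sub>F k in sequentially. inverse (real (Suc (s k))) < e / 3"
        using e by (rule order_tendstoD)
      have ev2: "\<forall>\<^sub>F k in sequentially. xk (s k) \<in> U \<inter> V"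
        by (rule topological_tendstoD[OF xs UV])
      have ev3: "\<forall>\<^sub>F k in sequentially. xk (s k) + tk (s k) *\<^sub>R u \<in> U \<inter> V"
        using topological_tendstoD[OF filterlim_compose[OF filterlim_base_shift base] UV] by simp
      have ev4: "\<forall>\<^sub>F k in sequentially. increment f (u, v) ((xk (s k), yk (s k)), tk (s k))
          \<le> (clarke_dir f (a, b) (u, v) + e / 3) * tk (s k)"
        using eventually_compose_filterlim[OF eventually_increment_le[OF f[OF bS] e, of "(u, v)"] base2] by simp
      have ev5: "\<forall>\<^sub>F k in sequentially. increment ?\<rho> (u, v) ((xk (s k), yk (s k)), tk (s k))
          \<le> (clarke_dir ?\<rho> (a, b) (u, v) + e / 3) * tk (s k)"
        using eventually_compose_filterlim[OF eventually_increment_le[OF pen[OF bS] e, of "(u, v)"] base2] by simp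
      have "\<forall>\<^sub>F k in sequentially. \<gamma> \<le> ?d + e"
        using ev1 ev2 ev3 ev4 ev5
      proof eventually_elim
        case (elim k)
        define x where "x = xk (s k)"
        define y where "y = yk (s k)"
        define t where "t = tk (s k)"
        have tpos: "0 < t" using \<open>\<And>k. 0 < tk k\<close> by (simp add: t_def)
        have y: "y \<in> F x" "f (x, y) = ?\<phi> x"
          using sol[of k] by (auto simp: solution_map_def x_def y_def)
        \<comment> \<open>At the base point the penalised bound is an equality, at the shifted point
          an inequality; subtracting compares the increments.\<close>
        have "?\<rho> (x, y) = 0"
          using y(1) by (simp add: graph_penalty_def)
        moreover have "real_of_ereal (?\<phi> (x + t *\<^sub>R u)) \<le>
            real_of_ereal (f (x + t *\<^sub>R u, y + t *\<^sub>R v)) + real_of_ereal (?\<rho> (x + t *\<^sub>R u, y + t *\<^sub>R v))"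
          using elim(3) by (intro marginal_le_penalised ne lip V(3)) (auto simp: x_def t_def)
        ultimately have "increment ?\<phi> u (x, t) \<le>
            increment f (u, v) ((x, y), t) + increment ?\<rho> (u, v) ((x, y), t)"
          using y(2) by simp
        also have "\<dots> \<le> (clarke_dir f (a, b) (u, v) + e / 3) * t + (clarke_dir ?\<rho> (a, b) (u, v) + e / 3) * t"
          using elim(4,5) unfolding x_def y_def t_def by (rule add_mono)
        finally have "(\<gamma> - inverse (real (Suc (s k)))) * t \<le> (?d + 2 * (e / 3)) * t"
          using inc[of "s k"] by (simp add: x_def t_def algebra_simps)
        then have "\<gamma> - inverse (real (Suc (s k))) \<le> ?d + 2 * (e / 3)"
          using tpos by simp
        then show ?case using elim(1) by linarith
      qed
      then show "\<gamma> \<le> ?d + e" by simp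
    qed
  qed
qed

text \<open>Applying \<open>mazur_orlicz\<close> on the product of two copies of the space, along the diagonal of
  \<open>{u} \<times> UNIV\<close>, yields the sum rule and the vanishing second component in one step.\<close>

lemma dominated_split_vanishing_on_snd:
  fixes p q :: "'a::real_normed_vector \<times> 'b::real_normed_vector \<Rightarrow> real"
  assumes p: "sublinear p" and q: "sublinear q"
    and bp: "\<And>w. p w \<le> K * norm w" and bq: "\<And>w. q w \<le> M * norm w"
    and \<gamma>: "\<And>v. \<gamma> \<le> p (u, v) + q (u, v)"
  obtains xs xs' :: "'a \<Rightarrow>\<^sub>L real" and ys :: "'b \<Rightarrow>\<^sub>L real"
  where "\<And>w. blinfun_apply (dual_pair xs ys) w \<le> p w"
    "\<And>w. blinfun_apply (dual_pair xs' (- ys)) w \<le> q w"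
    "\<gamma> \<le> blinfun_apply (xs + xs') u"
proof -
  define P where "P w = p (fst w) + q (snd w)" for w
  define C where "C = range (\<lambda>v::'b. ((u, v), (u, v)))"
  have P: "sublinear P"
  proof (rule sublinearI)
    show "P (x + y) \<le> P x + P y" for x y
      using sublinear_add[OF p, of "fst x" "fst y"] sublinear_add[OF q, of "snd x" "snd y"]
      by (simp add: P_def)
    show "P (c *\<^sub>R x) \<le> c * P x" if "0 < c" for c x
      using that by (simp add: P_def sublinear_scale[OF p] sublinear_scale[OF q] distrib_left)
    show "P 0 \<le> 0"
      by (simp add: P_def sublinear_0[OF p] sublinear_0[OF q])
  qed
  have C: "convex C"
  proof (rule convexI)
    fix x y and s t :: real
    assume "x \<in> C" "y \<in> C" and st: "0 \<le> s" "0 \<le> t" "s + t = 1"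
    then obtain v w where vw: "x = ((u, v), (u, v))" "y = ((u, w), (u, w))"
      by (auto simp: C_def)
    have "s *\<^sub>R u + t *\<^sub>R u = u"
      using st(3) by (simp flip: scaleR_add_left)
    then show "s *\<^sub>R x + t *\<^sub>R y \<in> C"
      by (auto simp: C_def vw intro!: image_eqI[of _ _ "s *\<^sub>R v + t *\<^sub>R w"])
  qed
  have "\<gamma> \<le> P k" if "k \<in> C" for k
    using that \<gamma> by (auto simp: C_def P_def)
  then obtain l where l: "linear l" "l \<le> P" and \<gamma>l: "\<And>k. k \<in> C \<Longrightarrow> \<gamma> \<le> l k"
    using mazur_orlicz[OF P C] by metis
  define a where "a z = l (z, 0)" for z
  define b where "b z = l (0, z)" for z
  have split: "l (z, w) = a z + b w" for z w
    using linear_add[OF l(1), of "(z, 0)" "(0, w)"] by (simp add: a_def b_def)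
  have lin: "linear a" "linear b"
    using linear_add[OF l(1), of "(_, 0)" "(_, 0)"] linear_scale[OF l(1), of _ "(_, 0)"]
      linear_add[OF l(1), of "(0, _)" "(0, _)"] linear_scale[OF l(1), of _ "(0, _)"]
    by (auto intro!: linearI simp: a_def b_def)
  \<comment> \<open>Setting one copy of the space to zero removes the other sublinear functional,
    which vanishes there.\<close>
  have ap: "a z \<le> p z" and bq': "b z \<le> q z" for z
    using le_funD[OF l(2), of "(z, 0)"] le_funD[OF l(2), of "(0, z)"]
    by (simp_all add: a_def b_def P_def sublinear_0[OF p] sublinear_0[OF q])
  have bl: "bounded_linear a" "bounded_linear b"
    using bounded_linear_of_le_norm[OF lin(1) order_trans[OF ap bp]]
      bounded_linear_of_le_norm[OF lin(2) order_trans[OF bq' bq]] .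
  obtain xs ys where xs: "Blinfun a = dual_pair xs (ys :: 'b \<Rightarrow>\<^sub>L real)"
    using bij_dual_pair[THEN bij_is_surj, THEN surjD, of "Blinfun a"] by auto
  obtain xs' ys' where xs': "Blinfun b = dual_pair xs' (ys' :: 'b \<Rightarrow>\<^sub>L real)"
    using bij_dual_pair[THEN bij_is_surj, THEN surjD, of "Blinfun b"] by auto
  have a: "a w = blinfun_apply (dual_pair xs ys) w" and b: "b w = blinfun_apply (dual_pair xs' ys') w" for w
    by (simp_all add: bounded_linear_Blinfun_apply[OF bl(1)] bounded_linear_Blinfun_apply[OF bl(2)]
        flip: xs xs')
  have ge: "\<gamma> \<le> blinfun_apply (xs + xs') u + blinfun_apply (ys + ys') v" for v
    using \<gamma>l[of "((u, v), (u, v))"] by (simp add: C_def split a b blinfun.add_left)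
  have "blinfun_apply (ys + ys') v = 0" for v
  proof (rule ccontr)
    assume nz: "blinfun_apply (ys + ys') v \<noteq> 0"
    \<comment> \<open>An affine function of \<open>v\<close> bounded below has no slope: at
      \<open>c *\<^sub>R v\<close> the right side of \<open>ge\<close> would equal
      \<open>\<gamma> - 1\<close>.\<close>
    define c where "c = (\<gamma> - 1 - blinfun_apply (xs + xs') u) / blinfun_apply (ys + ys') v"
    show False
      using ge[of "c *\<^sub>R v"] nz by (simp add: c_def blinfun.scaleR_right)
  qed
  then have "ys' = - ys"
    by (intro blinfun_eqI) (simp add: blinfun.add_left blinfun.minus_left add_eq_0_iff)
  with that[of xs ys xs'] show thesis
    using ap bq' ge[of 0] a b by (simp add: blinfun.zero_right)
qed

theorem theorem3p8:
  fixes F :: "'a::banach \<Rightarrow> 'b::banach set"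
    and f :: "'a \<times> 'b \<Rightarrow> ereal"
    and xb :: 'a
  assumes "\<And>x. F x \<noteq> {}"
    and "\<And>y. y \<in> solution_map f F xb \<Longrightarrow> aubin_property F (xb, y)"
    and "\<exists>U L1. open U \<and> xb \<in> U \<and> 0 < L1 \<and>
           (\<forall>x\<in>U. ext_lipschitz_on L1 UNIV (\<lambda>y. f (x, y)) \<and> closed (F x))"
    and "\<And>y. y \<in> solution_map f F xb \<Longrightarrow> locally_lipschitz_at f (xb, y)"
    and "locally_lipschitz_at (marginal f F) xb"
    and "inner_semicompact_at (solution_map f F) xb"
    and "closed_mapping_at (solution_map f F) xb"
  shows "clarke_subdiff (marginal f F) xb
    \<subseteq> weak_star_topology closure_of
        (convex hull
          (\<Union>yb\<in>solution_map f F xb.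
            \<Union>(xs, ys)\<in>{(xs, ys). dual_pair xs ys \<in> clarke_subdiff f (xb, yb)}.
              (\<lambda>w. xs + w) ` clarke_coderiv F (xb, yb) ys))"
    (is "_ \<subseteq> _ closure_of (convex hull ?B)")
proof (rule subsetI, rule ccontr)
  fix z assume z: "z \<in> clarke_subdiff (marginal f F) xb"
    and notin: "z \<notin> weak_star_topology closure_of (convex hull ?B)"
  define B where "B = ?B"
  \<comment> \<open>It now suffices to find a single point of \<open>B\<close> whose value at
    \<open>u\<close> is at least that of \<open>z\<close>.\<close>
  obtain u where u: "\<And>w. w \<in> convex hull B \<Longrightarrow> blinfun_apply w u < blinfun_apply z u"
    using weak_star_separation[OF convex_convex_hull notin[folded B_def]] by blast
  have zu: "blinfun_apply z u \<le> clarke_dir (marginal f F) xb u"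
    using z by (simp add: mem_clarke_subdiff_iff[OF assms(5)])
  obtain U L where U: "open U" "xb \<in> U" and L: "0 < L"
    and lip: "\<And>x. x \<in> U \<Longrightarrow> ext_lipschitz_on L UNIV (\<lambda>y. f (x, y))"
    using assms(3) by blast
  have solF: "y \<in> F xb" if "y \<in> solution_map f F xb" for y
    using that by (simp add: solution_map_def)
  have pen: "locally_lipschitz_at (graph_penalty L F) (xb, y)" if "y \<in> solution_map f F xb" for y
    using assms(1,2) solF[OF that] that L by (intro locally_lipschitz_graph_penalty)
  obtain yb where yb: "yb \<in> solution_map f F xb"
    and dir: "\<And>v. blinfun_apply z u \<le>
      clarke_dir f (xb, yb) (u, v) + clarke_dir (graph_penalty L F) (xb, yb) (u, v)"
    using clarke_dir_marginal_le[OF assms(1) L U lip assms(4) pen assms(5-7) zu] by blast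
  note f = assms(4)[OF yb] and \<rho> = pen[OF yb]
  obtain K where K: "\<And>w. clarke_dir f (xb, yb) w \<le> K * norm w"
    using clarke_dir_bounded[OF f] by blast
  obtain M where M: "\<And>w. clarke_dir (graph_penalty L F) (xb, yb) w \<le> M * norm w"
    using clarke_dir_bounded[OF \<rho>] by blast
  show False
  proof (rule dominated_split_vanishing_on_snd[OF sublinear_clarke_dir[OF f] sublinear_clarke_dir[OF \<rho>] K M dir])
    fix xs xs' ys
    assume sub: "\<And>w. blinfun_apply (dual_pair xs ys) w \<le> clarke_dir f (xb, yb) w"
      and nor: "\<And>w. blinfun_apply (dual_pair xs' (- ys)) w \<le> clarke_dir (graph_penalty L F) (xb, yb) w"
      and ge: "blinfun_apply z u \<le> blinfun_apply (xs + xs') u"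
    have "dual_pair xs ys \<in> clarke_subdiff f (xb, yb)"
      using sub by (simp add: mem_clarke_subdiff_iff[OF f])
    \<comment> \<open>The functional \<open>dual_pair xs' (- ys)\<close> is dominated by a
      derivative that is nonpositive on the tangent cone, so it is a normal; the sign of
      \<open>- ys\<close> matches the coderivative.\<close>
    moreover have "xs' \<in> clarke_coderiv F (xb, yb) ys"
      using order_trans[OF nor clarke_dir_graph_penalty_le_0[OF \<rho> solF[OF yb] assms(1) L]]
      by (simp add: clarke_coderiv_def clarke_normal_def)
    ultimately have "xs + xs' \<in> B"
      unfolding B_def using yb by blast
    then have "blinfun_apply (xs + xs') u < blinfun_apply z u"
      by (intro u hull_inc)
    with ge show False by simp
  qed
qed

end
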